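(* Let $S(G)$ denote the subdivision graph of a graph $G$. For finite simple connected graphs $G$ of order $n\geq 3$ the following hold: (1) If $G\not\cong C_n$ and $D(G)\geq 3$, then $\chi_D(S(G))\leq D(G)$. (2) The bound in (1) is sharp: there exists a finite simple connected graph $G$ of order $n\geq 3$ with $G\not\cong C_n$ and $D(G)\geq 3$ such that $\chi_D(S(G))=D(G)$. (3) If $G\not\cong C_n$ and $D(G)=2$, then $\chi_D(S(G))=3$. (4) If $D(G)=1$, then $\chi_D(S(G))=2$. (5) If $G\cong C_n$ with $n=3$ or $n\geq 6$, then $\chi_D(S(G))=D(G)+1$. (6) If $G\cong C_n$ with $n=4$ or $n=5$, then $\chi_D(S(G))=D(G)$.
   Context: $C_n$ is the cycle on $n$ vertices. The subdivision graph $S(G)$ of $G=(V(G),E(G))$ is the bipartite graph with vertex set $V(G)\cup E(G)$ (disjoint union) in which $v\in V(G)$ and $e\in E(G)$ are adjacent if and only if $v$ is incident with $e$ in $G$ (and there are no other adjacencies). A vertex coloring $h:V(H)\to\{1,\dots,r\}$ of a graph $H$ is distinguishing if the only automorphism $\psi$ of $H$ with $h(\psi(v))=h(v)$ for all $v\in V(H)$ is the identity. The distinguishing number $D(H)$ is the least $r$ such that $H$ has a distinguishing vertex coloring with colors $\{1,\dots,r\}$ (not necessarily proper). The distinguishing chromatic number $\chi_D(H)$ is the least $r$ such that $H$ has a vertex coloring with colors $\{1,\dots,r\}$ that is both proper and distinguishing. *)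

theory Defs
  imports "Graph_Theory.Graph_Theory"
begin

text \<open>
  Finite simple graphs are represented by the locale \<open>pair_graph\<close>, i.e. by finite loopless
  symmetric digraphs without parallel arcs: an undirected edge is a pair of opposite arcs, and
  adjacency of \<open>u\<close> and \<open>v\<close> is \<open>(u, v) \<in> parcs G\<close>. Connectedness and isomorphism are \<open>connected\<close> and
  \<open>digraph_iso\<close> applied to \<open>with_proj G\<close>; on symmetric digraphs these are the usual notions
  for undirected graphs.
\<close>

definition edges :: "'a pair_pre_digraph \<Rightarrow> 'a set set" where
  "edges G = {{u, v} | u v. (u, v) \<in> parcs G}"

definition cycle_graph :: "nat \<Rightarrow> nat pair_pre_digraph" where
  "cycle_graph n =
     \<lparr> pverts = {0..<n},
       parcs = {(i, j). i < n \<and> j < n \<and> (j = (i + 1) mod n \<or> i = (j + 1) mod n)} \<rparr>"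

definition subdivision_graph :: "'a pair_pre_digraph \<Rightarrow> ('a + 'a set) pair_pre_digraph" where
  "subdivision_graph G =
     \<lparr> pverts = pverts G <+> edges G,
       parcs = {(Inl v, Inr e) | v e. v \<in> pverts G \<and> e \<in> edges G \<and> v \<in> e}
             \<union> {(Inr e, Inl v) | v e. v \<in> pverts G \<and> e \<in> edges G \<and> v \<in> e} \<rparr>"

text \<open>The values of \<open>\<psi>\<close> and of colorings outside \<open>pverts G\<close> are irrelevant.\<close>

definition automorphism :: "'a pair_pre_digraph \<Rightarrow> ('a \<Rightarrow> 'a) \<Rightarrow> bool" where
  "automorphism G \<psi> \<longleftrightarrow> bij_betw \<psi> (pverts G) (pverts G) \<and>
     (\<forall>u\<in>pverts G. \<forall>v\<in>pverts G. (\<psi> u, \<psi> v) \<in> parcs G \<longleftrightarrow> (u, v) \<in> parcs G)"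

definition vertex_coloring :: "'a pair_pre_digraph \<Rightarrow> nat \<Rightarrow> ('a \<Rightarrow> nat) \<Rightarrow> bool" where
  "vertex_coloring G r h \<longleftrightarrow> (\<forall>v\<in>pverts G. h v \<in> {1..r})"

definition proper_coloring :: "'a pair_pre_digraph \<Rightarrow> ('a \<Rightarrow> nat) \<Rightarrow> bool" where
  "proper_coloring G h \<longleftrightarrow> (\<forall>(u, v)\<in>parcs G. h u \<noteq> h v)"

definition distinguishing :: "'a pair_pre_digraph \<Rightarrow> ('a \<Rightarrow> nat) \<Rightarrow> bool" where
  "distinguishing G h \<longleftrightarrow>
     (\<forall>\<psi>. automorphism G \<psi> \<and> (\<forall>v\<in>pverts G. h (\<psi> v) = h v) \<longrightarrow> (\<forall>v\<in>pverts G. \<psi> v = v))"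

text \<open>
  For finite simple graphs both minima below are attained, as an injective coloring is proper and
  distinguishing.
\<close>

definition distinguishing_number :: "'a pair_pre_digraph \<Rightarrow> nat" where
  "distinguishing_number G = (LEAST r. \<exists>h. vertex_coloring G r h \<and> distinguishing G h)"

definition distinguishing_chromatic_number :: "'a pair_pre_digraph \<Rightarrow> nat" where
  "distinguishing_chromatic_number G =
     (LEAST r. \<exists>h. vertex_coloring G r h \<and> proper_coloring G h \<and> distinguishing G h)"

definition connected_graph_of_order :: "nat \<Rightarrow> 'a pair_pre_digraph \<Rightarrow> bool" where
  "connected_graph_of_order n G \<longleftrightarrow>
     pair_graph G \<and> connected (with_proj G) \<and> card (pverts G) = n"

definition isomorphic :: "'a pair_pre_digraph \<Rightarrow> 'b pair_pre_digraph \<Rightarrow> bool" where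
  "isomorphic G H \<longleftrightarrow> digraph_iso (with_proj G) (with_proj H)"

end

theory Submission
  imports Defs
begin

text \<open>
  Unless \<open>G\<close> is a cycle, every automorphism of \<open>S(G)\<close> preserves the set \<open>V(G)\<close>: one that maps some
  vertex of \<open>G\<close> to an edge maps all of them to edges, by connectedness, so all degrees are 2. Hence
  the automorphisms of \<open>S(G)\<close> are those induced by automorphisms of \<open>G\<close>. If \<open>r \<ge> 3\<close>, a distinguishing
  \<open>r\<close>-coloring of \<open>G\<close> extends to a proper coloring of \<open>S(G)\<close>, since each edge only has to avoid the
  colors of its two ends. A proper 2-coloring of \<open>S(G)\<close> is constant on vertices and on edges, so it
  is distinguishing only if \<open>G\<close> has no nontrivial automorphism. For a cycle, \<open>S(C\<^sub>n)\<close> is \<open>C\<^sub>2\<^sub>n\<close>,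
  and both numbers are computed directly from the rotations and reflections.
\<close>

section \<open>Graph isomorphisms\<close>

text \<open>The exclusion of cycles enters (1) and (3) through \<open>two_regular\<close>: rotating
  \<open>cycle_graph (2 * n)\<close> by one step swaps the vertices and the edges of the original
  cycle, and conversely a connected graph whose subdivision admits such a swap is two-regular, hence
  a cycle. Cases (5) and (6) come from two thresholds that do not coincide. With at most five
  vertices, one class of any 2-coloring has at most two elements, and every such set is symmetric
  under a reflection of the cycle, so \<open>D\<close> is 3; from six vertices on, a class of three
  vertices can break all symmetry and \<open>D\<close> is 2. For the subdivided cycle, three colors
  suffice except on the hexagon, the subdivision of the triangle, which needs four. The pairs
  (\<open>\<chi>\<^sub>D\<close> of the subdivision, \<open>D\<close> of the cycle) are therefore
  (4, 3) for \<open>n = 3\<close>, (3, 3) for \<open>n = 4, 5\<close>, and (3, 2) from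
  \<open>n = 6\<close> on. Sharpness in (2) comes from the star with three leaves: its leaves can be
  permuted freely, so they need three different colors.\<close>

definition graph_iso :: "'a pair_pre_digraph \<Rightarrow> 'b pair_pre_digraph \<Rightarrow> ('a \<Rightarrow> 'b) \<Rightarrow> bool" where
  "graph_iso G H f \<longleftrightarrow> bij_betw f (pverts G) (pverts H) \<and>
     (\<forall>u\<in>pverts G. \<forall>v\<in>pverts G. (f u, f v) \<in> parcs H \<longleftrightarrow> (u, v) \<in> parcs G)"

lemma automorphism_iff_graph_iso: "automorphism G \<psi> \<longleftrightarrow> graph_iso G G \<psi>"
  by (simp add: automorphism_def graph_iso_def)

lemma graph_iso_in_verts: "graph_iso G H f \<Longrightarrow> v \<in> pverts G \<Longrightarrow> f v \<in> pverts H"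
  by (auto simp: graph_iso_def bij_betw_def)

lemma graph_iso_comp:
  assumes "graph_iso G H f" "graph_iso H K g"
  shows "graph_iso G K (g \<circ> f)"
  using assms graph_iso_in_verts[OF assms(1)]
  by (auto simp: graph_iso_def intro: bij_betw_trans)

lemma graph_iso_inv:
  assumes "graph_iso G H f"
  shows "graph_iso H G (the_inv_into (pverts G) f)"
proof -
  let ?g = "the_inv_into (pverts G) f"
  have b: "bij_betw f (pverts G) (pverts H)" using assms by (simp add: graph_iso_def)
  have b': "bij_betw ?g (pverts H) (pverts G)" using b by (rule bij_betw_the_inv_into)
  have "(?g u, ?g v) \<in> parcs G \<longleftrightarrow> (u, v) \<in> parcs H" if "u \<in> pverts H" "v \<in> pverts H" for u v
  proof -
    have "?g u \<in> pverts G" "?g v \<in> pverts G" using b' that by (auto simp: bij_betw_def)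
    moreover have "f (?g u) = u" "f (?g v) = v"
      using b that by (auto intro: f_the_inv_into_f_bij_betw)
    ultimately show ?thesis using assms unfolding graph_iso_def by metis
  qed
  then show ?thesis using b' by (simp add: graph_iso_def)
qed

text \<open>A library isomorphism carries separate maps for vertices and arcs. Arcs here are pairs
  with \<open>fst\<close> and \<open>snd\<close> as end maps, so the arc map is determined by the
  vertex map, and the latter is all that later arguments handle.\<close>

lemma isomorphic_imp_graph_iso:
  assumes "isomorphic G H" "pair_wf_digraph G"
  obtains f where "graph_iso G H f"
proof -
  interpret pair_wf_digraph G by fact
  obtain h where h: "digraph_isomorphism h" and H: "with_proj H = app_iso h (with_proj G)"
    using assms(1) unfolding isomorphic_def digraph_iso_def by auto
  have V: "pverts H = iso_verts h ` pverts G"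
    using arg_cong[OF H, of verts] by simp
  have E: "parcs H = iso_arcs h ` parcs G"
    using arg_cong[OF H, of arcs] by simp
  \<comment> \<open>\<open>app_iso\<close> installs the end maps of \<open>h\<close> in its result,
    and on the left these are the projections.\<close>
  have T: "iso_tail h = fst" "iso_head h = snd"
    using arg_cong[OF H, of tail] arg_cong[OF H, of head] by simp_all
  have inj: "inj_on (iso_verts h) (pverts G)"
    using h by (simp add: digraph_isomorphism_def)
  have A: "iso_arcs h a = (iso_verts h (fst a), iso_verts h (snd a))" if "a \<in> parcs G" for a
    using h that T by (auto simp: digraph_isomorphism_def prod_eq_iff)
  have "graph_iso G H (iso_verts h)"
    unfolding graph_iso_def
  proof (intro conjI ballI)
    show "bij_betw (iso_verts h) (pverts G) (pverts H)" using inj V by (simp add: bij_betw_def)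
    fix u v assume uv: "u \<in> pverts G" "v \<in> pverts G"
    have "a = (u, v)" if "a \<in> parcs G" "iso_arcs h a = (iso_verts h u, iso_verts h v)" for a
      using A[OF that(1)] that inj uv arc_fst_in_verts[OF that(1)] arc_snd_in_verts[OF that(1)]
      by (auto simp: inj_on_eq_iff prod_eq_iff)
    then show "((iso_verts h u, iso_verts h v) \<in> parcs H) = ((u, v) \<in> parcs G)"
      using A[of "(u, v)"] unfolding E by (force simp: image_iff)
  qed
  then show thesis by (rule that)
qed

lemma pair_graph_imp_pair_wf_digraph: "pair_graph G \<Longrightarrow> pair_wf_digraph G"
  using pair_digraph.pair_wf_digraph pair_graph.axioms(1) by blast

lemma graph_iso_imp_isomorphic:
  assumes "graph_iso G H f" "pair_wf_digraph G" "pair_wf_digraph H"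
  shows "isomorphic G H"
proof -
  interpret G: pair_wf_digraph G by fact
  interpret H: pair_wf_digraph H by fact
  let ?h = "\<lparr>iso_verts = f, iso_arcs = map_prod f f, iso_head = snd, iso_tail = fst\<rparr>"
  have inj: "inj_on f (pverts G)" and V: "pverts H = f ` pverts G"
    using assms(1) by (auto simp: graph_iso_def bij_betw_def)
  have "parcs G \<subseteq> pverts G \<times> pverts G" by (auto dest: G.in_arcsD1 G.in_arcsD2)
  then have "inj_on (map_prod f f) (parcs G)"
    using map_prod_inj_on[OF inj inj] by (rule inj_on_subset[rotated])
  then have "G.digraph_isomorphism ?h"
    using inj G.wf_digraph_axioms by (auto simp: G.digraph_isomorphism_def)
  moreover have "parcs H = map_prod f f ` parcs G"
  proof (intro equalityI subsetI)
    fix a assume a: "a \<in> parcs H"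
    then have "fst a \<in> f ` pverts G" "snd a \<in> f ` pverts G"
      using H.arc_fst_in_verts[OF a] H.arc_snd_in_verts[OF a] V by auto
    then obtain u v where uv: "u \<in> pverts G" "v \<in> pverts G" "a = map_prod f f (u, v)"
      by (auto simp: prod_eq_iff)
    then have "(u, v) \<in> parcs G" using assms(1) a by (simp add: graph_iso_def)
    then show "a \<in> map_prod f f ` parcs G" using uv(3) by blast
  next
    fix a assume "a \<in> map_prod f f ` parcs G"
    then show "a \<in> parcs H"
      using assms(1) by (auto simp: graph_iso_def dest: G.in_arcsD1 G.in_arcsD2)
  qed
  then have "with_proj H = app_iso ?h (with_proj G)"
    using V by (simp add: with_proj_def app_iso_def)
  ultimately show ?thesis
    unfolding isomorphic_def digraph_iso_def by blast
qed

text \<open>Conjugation by \<open>f\<close> turns a color-preserving automorphism of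
  \<open>G\<close> into one of \<open>H\<close>, which must be trivial.\<close>

lemma distinguishing_graph_iso:
  assumes f: "graph_iso G H f" and h: "distinguishing H h"
  shows "distinguishing G (h \<circ> f)"
  unfolding distinguishing_def
proof (intro allI impI ballI)
  fix \<psi> v
  let ?g = "the_inv_into (pverts G) f"
  assume \<psi>: "automorphism G \<psi> \<and> (\<forall>v\<in>pverts G. (h \<circ> f) (\<psi> v) = (h \<circ> f) v)" and v: "v \<in> pverts G"
  have g: "graph_iso H G ?g" using f by (rule graph_iso_inv)
  have b: "bij_betw f (pverts G) (pverts H)" using f by (simp add: graph_iso_def)
  have fg: "f (?g u) = u" if "u \<in> pverts H" for u
    using b that by (rule f_the_inv_into_f_bij_betw)
  have gf: "?g (f u) = u" if "u \<in> pverts G" for u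
    using b that by (auto simp: bij_betw_def the_inv_into_f_f)
  let ?\<phi> = "f \<circ> (\<psi> \<circ> ?g)"
  have "automorphism H ?\<phi>"
    using \<psi> f g by (auto simp: automorphism_iff_graph_iso intro: graph_iso_comp)
  moreover have "h (?\<phi> u) = h u" if "u \<in> pverts H" for u
    using \<psi> graph_iso_in_verts[OF g that] fg[OF that] by simp
  ultimately have "?\<phi> (f v) = f v"
    using h graph_iso_in_verts[OF f v] unfolding distinguishing_def by blast
  then have "f (\<psi> v) = f v" using gf[OF v] by simp
  moreover have "\<psi> v \<in> pverts G"
    using \<psi> v by (auto simp: automorphism_iff_graph_iso intro: graph_iso_in_verts)
  ultimately show "\<psi> v = v" using b v by (auto simp: bij_betw_def inj_on_def)
qed

lemma vertex_coloring_graph_iso: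
  assumes "graph_iso G H f" "vertex_coloring H r h"
  shows "vertex_coloring G r (h \<circ> f)"
  using assms graph_iso_in_verts[OF assms(1)] by (auto simp: vertex_coloring_def)

lemma proper_coloring_graph_iso:
  assumes "pair_wf_digraph G" "graph_iso G H f" "proper_coloring H h"
  shows "proper_coloring G (h \<circ> f)"
proof -
  interpret pair_wf_digraph G by fact
  show ?thesis using assms(2,3)
    by (fastforce simp: proper_coloring_def graph_iso_def dest: in_arcsD1 in_arcsD2)
qed

lemma distinguishing_number_graph_iso:
  assumes "graph_iso G H f"
  shows "distinguishing_number G = distinguishing_number H"
proof -
  have "(\<exists>h. vertex_coloring G r h \<and> distinguishing G h) \<longleftrightarrow>
        (\<exists>h. vertex_coloring H r h \<and> distinguishing H h)" for r
    using assms graph_iso_inv[OF assms] distinguishing_graph_iso vertex_coloring_graph_iso by metis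
  then show ?thesis by (simp add: distinguishing_number_def)
qed

lemma distinguishing_chromatic_number_graph_iso:
  assumes "pair_wf_digraph G" "pair_wf_digraph H" "graph_iso G H f"
  shows "distinguishing_chromatic_number G = distinguishing_chromatic_number H"
proof -
  have "(\<exists>h. vertex_coloring G r h \<and> proper_coloring G h \<and> distinguishing G h) \<longleftrightarrow>
        (\<exists>h. vertex_coloring H r h \<and> proper_coloring H h \<and> distinguishing H h)" for r
    using assms graph_iso_inv[OF assms(3)] distinguishing_graph_iso vertex_coloring_graph_iso
      proper_coloring_graph_iso by metis
  then show ?thesis by (simp add: distinguishing_chromatic_number_def)
qed

section \<open>Colorings\<close>

text \<open>Provides the colorings that make both \<open>LEAST\<close> expressions meaningful.
  Injectivity is kept in the conclusion because on a loopless graph it also yields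
  properness.\<close>

lemma ex_inj_coloring:
  assumes "finite (pverts G)"
  obtains r h where "vertex_coloring G r h" "inj_on h (pverts G)" "distinguishing G h"
proof -
  obtain h where h: "bij_betw h (pverts G) {1..card (pverts G)}"
    using assms finite_same_card_bij[of "pverts G" "{1..card (pverts G)}"] by auto
  then have i: "inj_on h (pverts G)" by (simp add: bij_betw_def)
  have "vertex_coloring G (card (pverts G)) h"
    using h by (auto simp: vertex_coloring_def bij_betw_def)
  moreover have "distinguishing G h"
    using i graph_iso_in_verts by (fastforce simp: distinguishing_def automorphism_iff_graph_iso dest: inj_onD)
  ultimately show thesis using i that by blast
qed

lemma vertex_coloring_mono: "vertex_coloring G r h \<Longrightarrow> r \<le> s \<Longrightarrow> vertex_coloring G s h"
  by (force simp: vertex_coloring_def)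

text \<open>Replaces \<open>LEAST\<close> by a threshold: the minimum is attained, and a coloring
  with \<open>r\<close> colors is also one with more. Upper bounds then need one coloring, and lower
  bounds refute all colorings with one color fewer.\<close>

lemma distinguishing_number_le_iff:
  assumes "finite (pverts G)"
  shows "distinguishing_number G \<le> r \<longleftrightarrow> (\<exists>h. vertex_coloring G r h \<and> distinguishing G h)"
proof
  let ?P = "\<lambda>r. \<exists>h. vertex_coloring G r h \<and> distinguishing G h"
  have "?P (distinguishing_number G)"
    unfolding distinguishing_number_def
    using ex_inj_coloring[OF assms] by (intro LeastI_ex[of ?P]) blast
  then show "distinguishing_number G \<le> r \<Longrightarrow> ?P r" using vertex_coloring_mono by blast
  show "?P r \<Longrightarrow> distinguishing_number G \<le> r"
    unfolding distinguishing_number_def by (rule Least_le)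
qed

lemma distinguishing_chromatic_number_le_iff:
  assumes "pair_graph G"
  shows "distinguishing_chromatic_number G \<le> r \<longleftrightarrow>
    (\<exists>h. vertex_coloring G r h \<and> proper_coloring G h \<and> distinguishing G h)"
proof
  interpret pair_graph G by fact
  let ?P = "\<lambda>r. \<exists>h. vertex_coloring G r h \<and> proper_coloring G h \<and> distinguishing G h"
  obtain s h where h: "vertex_coloring G s h" "inj_on h (pverts G)" "distinguishing G h"
    using ex_inj_coloring[OF pair_finite_verts] .
  have "h u \<noteq> h v" if "(u, v) \<in> parcs G" for u v
    using h(2) in_arcsD1[OF that] in_arcsD2[OF that] no_loops'[OF that] by (auto dest: inj_onD)
  then have "?P s" using h by (auto simp: proper_coloring_def)
  then have "?P (distinguishing_chromatic_number G)"
    unfolding distinguishing_chromatic_number_def by (rule LeastI[of ?P])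
  then show "distinguishing_chromatic_number G \<le> r \<Longrightarrow> ?P r" using vertex_coloring_mono by blast
  show "?P r \<Longrightarrow> distinguishing_chromatic_number G \<le> r"
    unfolding distinguishing_chromatic_number_def by (rule Least_le)
qed

lemma pair_graphI:
  assumes "finite (pverts G)" "\<And>u v. (u, v) \<in> parcs G \<Longrightarrow> u \<in> pverts G \<and> (v, u) \<in> parcs G \<and> u \<noteq> v"
  shows "pair_graph G"
proof
  have "parcs G \<subseteq> pverts G \<times> pverts G" using assms(2) by auto
  then show "finite (parcs G)" by (rule finite_subset) (simp add: assms(1))
  show "symmetric (with_proj G)" using assms(2) by (auto simp: symmetric_def intro!: symI)
  show "finite (pverts G)" by (fact assms(1))
  fix e assume "e \<in> parcs G"
  then have "fst e \<in> pverts G \<and> (snd e, fst e) \<in> parcs G \<and> fst e \<noteq> snd e"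
    using assms(2)[of "fst e" "snd e"] by simp
  then show "fst e \<in> pverts G" "snd e \<in> pverts G" "fst e \<noteq> snd e" using assms(2) by auto
qed

text \<open>A property that passes along arcs holds everywhere or nowhere: by symmetry,
  connectedness gives directed paths in both directions between any two vertices.\<close>

lemma connected_pair_graph_induct [consumes 4, case_names step]:
  assumes "pair_graph G" "connected (with_proj G)" "v \<in> pverts G" "u \<in> pverts G"
    "\<And>x y. (x, y) \<in> parcs G \<Longrightarrow> P x \<Longrightarrow> P y"
  shows "P u \<longleftrightarrow> P v"
proof -
  interpret pair_graph G by fact
  have *: "P a \<Longrightarrow> P b" if "a \<in> pverts G" "b \<in> pverts G" for a b
  proof -
    have "a \<rightarrow>\<^sup>*\<^bsub>with_proj G\<^esub> b"
      using symmetric_connected_imp_strongly_connected[OF sym_arcs assms(2)] that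
      by (auto simp: strongly_connected_def)
    then show "P a \<Longrightarrow> P b"
      unfolding reachable_def by (induct rule: rtrancl_on_induct) (auto intro: assms(5))
  qed
  then show ?thesis using assms(3,4) by blast
qed

section \<open>Automorphisms of subdivision graphs\<close>

lemma automorphism_in_verts: "automorphism G \<psi> \<Longrightarrow> v \<in> pverts G \<Longrightarrow> \<psi> v \<in> pverts G"
  by (auto simp: automorphism_iff_graph_iso intro: graph_iso_in_verts)

lemma subdivision_graph_simps [simp]:
  "Inl v \<in> pverts (subdivision_graph G) \<longleftrightarrow> v \<in> pverts G"
  "Inr e \<in> pverts (subdivision_graph G) \<longleftrightarrow> e \<in> edges G"
  "(Inl v, Inr e) \<in> parcs (subdivision_graph G) \<longleftrightarrow> v \<in> pverts G \<and> e \<in> edges G \<and> v \<in> e"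
  "(Inr e, Inl v) \<in> parcs (subdivision_graph G) \<longleftrightarrow> v \<in> pverts G \<and> e \<in> edges G \<and> v \<in> e"
  "(Inl v, Inl w) \<notin> parcs (subdivision_graph G)"
  "(Inr e, Inr e') \<notin> parcs (subdivision_graph G)"
  by (auto simp: subdivision_graph_def)

lemma subdivision_vertE:
  assumes "a \<in> pverts (subdivision_graph G)"
  obtains (Inl) v where "a = Inl v" "v \<in> pverts G" | (Inr) e where "a = Inr e" "e \<in> edges G"
  using assms by (auto simp: subdivision_graph_def)

lemma subdivision_arcE:
  assumes "(a, b) \<in> parcs (subdivision_graph G)"
  obtains v e where "v \<in> pverts G" "e \<in> edges G" "v \<in> e"
    "a = Inl v \<and> b = Inr e \<or> a = Inr e \<and> b = Inl v"
  using assms by (auto simp: subdivision_graph_def)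

context pair_graph
begin

lemma insert_in_edges_iff: "{u, v} \<in> edges G \<longleftrightarrow> (u, v) \<in> parcs G"
  by (auto simp: edges_def doubleton_eq_iff intro: arcs_symmetric)

lemma edgesE:
  assumes "e \<in> edges G"
  obtains u v where "e = {u, v}" "(u, v) \<in> parcs G" "u \<noteq> v" "u \<in> pverts G" "v \<in> pverts G"
  using assms unfolding edges_def by (blast dest: in_arcsD1 in_arcsD2 no_loops')

lemma edges_atE:
  assumes "e \<in> edges G" "v \<in> e"
  obtains u where "e = {v, u}" "(v, u) \<in> parcs G" "u \<noteq> v" "u \<in> pverts G"
  using assms(1)
proof (rule edgesE)
  fix x y assume *: "e = {x, y}" "(x, y) \<in> parcs G" "x \<noteq> y" "x \<in> pverts G" "y \<in> pverts G"
  show thesis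
  proof (cases "v = x")
    case True
    then show ?thesis using that[of y] * by blast
  next
    case False
    then have "v = y" using * assms(2) by blast
    then show ?thesis using that[of x] * arcs_symmetric by blast
  qed
qed

lemma finite_edges: "finite (edges G)"
proof (rule finite_subset)
  show "edges G \<subseteq> Pow (pverts G)" by (auto elim: edgesE)
qed (simp add: pair_finite_verts)

lemma pair_graph_subdivision_graph: "pair_graph (subdivision_graph G)"
proof (rule pair_graphI)
  show "finite (pverts (subdivision_graph G))"
    by (simp add: subdivision_graph_def pair_finite_verts finite_edges)
qed (auto elim!: subdivision_arcE)

text \<open>Adjacency in \<open>G\<close> can be read off from the subdivision graph, since an edge
  containing two distinct vertices joins them. This is how an automorphism that keeps vertices among
  vertices restricts to one of \<open>G\<close>.\<close>

lemma arc_iff_common_subdivision_neighbour: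
  assumes "u \<in> pverts G" "v \<in> pverts G"
  shows "(u, v) \<in> parcs G \<longleftrightarrow> u \<noteq> v \<and> (\<exists>z\<in>pverts (subdivision_graph G).
    (Inl u, z) \<in> parcs (subdivision_graph G) \<and> (Inl v, z) \<in> parcs (subdivision_graph G))"
proof
  assume "(u, v) \<in> parcs G"
  then show "u \<noteq> v \<and> (\<exists>z\<in>pverts (subdivision_graph G).
    (Inl u, z) \<in> parcs (subdivision_graph G) \<and> (Inl v, z) \<in> parcs (subdivision_graph G))"
    using assms no_loops' insert_in_edges_iff[of u v]
    by (intro conjI bexI[of _ "Inr {u, v}"]) auto
next
  assume *: "u \<noteq> v \<and> (\<exists>z\<in>pverts (subdivision_graph G).
    (Inl u, z) \<in> parcs (subdivision_graph G) \<and> (Inl v, z) \<in> parcs (subdivision_graph G))"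
  then obtain e where "e \<in> edges G" "u \<in> e" "v \<in> e" by (auto elim: subdivision_vertE)
  then show "(u, v) \<in> parcs G" using * by (auto elim!: edges_atE[of e u])
qed

end

text \<open>Stands in for "is a cycle" on connected graphs. Naming the two neighbors, instead of
  counting them, hands their witnesses directly to the proofs.\<close>

definition two_regular :: "'a pair_pre_digraph \<Rightarrow> bool" where
  "two_regular G \<longleftrightarrow> (\<forall>v\<in>pverts G. \<exists>x y. x \<noteq> y \<and> {u. (v, u) \<in> parcs G} = {x, y})"

locale subdivision_automorphism = pair_graph G for G :: "'a pair_pre_digraph" +
  fixes \<psi> :: "'a + 'a set \<Rightarrow> 'a + 'a set"
  assumes connected_G: "connected (with_proj G)"
    and automorphism_\<psi>: "automorphism (subdivision_graph G) \<psi>"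
begin

abbreviation "S \<equiv> subdivision_graph G"

lemma psi_in: "a \<in> pverts S \<Longrightarrow> \<psi> a \<in> pverts S"
  using automorphism_in_verts[OF automorphism_\<psi>] .

lemma psi_arc: "a \<in> pverts S \<Longrightarrow> b \<in> pverts S \<Longrightarrow> (\<psi> a, \<psi> b) \<in> parcs S \<longleftrightarrow> (a, b) \<in> parcs S"
  using automorphism_\<psi> by (simp add: automorphism_def)

lemma psi_inj: "inj_on \<psi> (pverts S)"
  using automorphism_\<psi> by (simp add: automorphism_def bij_betw_def)

lemma psi_eq_iff: "a \<in> pverts S \<Longrightarrow> b \<in> pverts S \<Longrightarrow> \<psi> a = \<psi> b \<longleftrightarrow> a = b"
  using psi_inj by (rule inj_on_eq_iff)

lemma psi_surj: "b \<in> pverts S \<Longrightarrow> \<exists>a\<in>pverts S. \<psi> a = b"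
  using automorphism_\<psi> unfolding automorphism_def bij_betw_def by (metis imageE)

text \<open>An arc of \<open>G\<close> becomes a path of length two through its edge. The image of
  that path has both ends on the same side of the bipartition.\<close>

lemma isl_psi_Inl_const:
  assumes "u \<in> pverts G" "v \<in> pverts G"
  shows "isl (\<psi> (Inl u)) \<longleftrightarrow> isl (\<psi> (Inl v))"
  using pair_graph connected_G assms(2,1)
proof (induction rule: connected_pair_graph_induct)
  case (step x y)
  have "x \<in> pverts G" "y \<in> pverts G" "{x, y} \<in> edges G"
    using step(1) in_arcsD1 in_arcsD2 by (auto simp: insert_in_edges_iff)
  then have "(\<psi> (Inl x), \<psi> (Inr {x, y})) \<in> parcs S" "(\<psi> (Inl y), \<psi> (Inr {x, y})) \<in> parcs S"
    by (simp_all add: psi_arc)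
  then show ?case using step(2) by (auto elim!: subdivision_arcE)
qed

text \<open>If \<open>v\<close> is sent to an edge \<open>{a, b}\<close>, the edges at
  \<open>v\<close> correspond under \<open>\<psi>\<close> to the neighbors of that edge in the
  subdivision graph, which are exactly \<open>a\<close> and \<open>b\<close>.\<close>

lemma swap_imp_two_regular:
  assumes "\<And>v. v \<in> pverts G \<Longrightarrow> \<not> isl (\<psi> (Inl v))"
  shows "two_regular G"
  unfolding two_regular_def
proof
  fix v assume v: "v \<in> pverts G"
  then obtain e where e: "\<psi> (Inl v) = Inr e" "e \<in> edges G"
    using assms[OF v] psi_in[of "Inl v"] by (auto elim: subdivision_vertE)
  obtain a b where ab: "e = {a, b}" "a \<noteq> b" "a \<in> pverts G" "b \<in> pverts G"
    using edgesE[OF e(2)] by metis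
  \<comment> \<open>Pulls an end of \<open>e\<close> back along \<open>\<psi>\<close>: its preimage
    is an edge at \<open>v\<close>.\<close>
  have pre: "\<exists>x. \<psi> (Inr {v, x}) = Inl c \<and> (v, x) \<in> parcs G \<and> {v, x} \<in> edges G" if c: "c \<in> e" for c
  proof -
    have "Inl c \<in> pverts S" using c ab by auto
    then obtain z where z: "z \<in> pverts S" "\<psi> z = Inl c" using psi_surj by blast
    have "(\<psi> (Inl v), \<psi> z) \<in> parcs S" using z e c ab by auto
    then have "(Inl v, z) \<in> parcs S" using z v psi_arc[of "Inl v" z] by simp
    then obtain f where "z = Inr f" "f \<in> edges G" "v \<in> f" by (auto elim: subdivision_arcE)
    then show ?thesis using z edges_atE[of f v] by metis
  qed
  obtain x where x: "\<psi> (Inr {v, x}) = Inl a" "(v, x) \<in> parcs G" "{v, x} \<in> edges G"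
    using pre[of a] ab by auto
  obtain y where y: "\<psi> (Inr {v, y}) = Inl b" "(v, y) \<in> parcs G" "{v, y} \<in> edges G"
    using pre[of b] ab by auto
  have "u \<in> {x, y}" if u: "(v, u) \<in> parcs G" for u
  proof -
    have vu: "{v, u} \<in> edges G" using u by (simp add: insert_in_edges_iff)
    then have "(\<psi> (Inl v), \<psi> (Inr {v, u})) \<in> parcs S" using v by (simp add: psi_arc)
    then have "\<psi> (Inr {v, u}) \<in> {Inl a, Inl b}" using e ab by (auto elim: subdivision_arcE)
    then have "\<psi> (Inr {v, u}) = \<psi> (Inr {v, x}) \<or> \<psi> (Inr {v, u}) = \<psi> (Inr {v, y})"
      using x y by auto
    then have "{v, u} = {v, x} \<or> {v, u} = {v, y}" using vu x(3) y(3) by (simp add: psi_eq_iff)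
    then show ?thesis by (auto simp: doubleton_eq_iff)
  qed
  then have "{u. (v, u) \<in> parcs G} = {x, y}" using x y by auto
  moreover have "x \<noteq> y" using x y ab by auto
  ultimately show "\<exists>x y. x \<noteq> y \<and> {u. (v, u) \<in> parcs G} = {x, y}" by blast
qed

lemma fixes_if_distinguishing:
  assumes "\<not> two_regular G" "distinguishing G (h \<circ> Inl)" "\<And>a. a \<in> pverts S \<Longrightarrow> h (\<psi> a) = h a"
    and "a \<in> pverts S"
  shows "\<psi> a = a"
proof -
  \<comment> \<open>Failure of two-regularity gives one vertex that remains a vertex, and then
    constancy of the side gives all of them.\<close>
  have "\<exists>w. \<psi> (Inl v) = Inl w" if "v \<in> pverts G" for v
    using assms(1) swap_imp_two_regular isl_psi_Inl_const[OF _ that] by (auto simp: isl_def)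
  then obtain \<phi> where \<phi>: "\<psi> (Inl v) = Inl (\<phi> v)" if "v \<in> pverts G" for v by metis
  have \<phi>_in: "\<phi> v \<in> pverts G" if "v \<in> pverts G" for v
    using psi_in[of "Inl v"] \<phi>[OF that] that by simp
  have \<phi>_eq: "\<phi> u = \<phi> v \<longleftrightarrow> u = v" if "u \<in> pverts G" "v \<in> pverts G" for u v
    using psi_eq_iff[of "Inl u" "Inl v"] that by (simp add: \<phi>)
  have "inj_on \<phi> (pverts G)" using \<phi>_eq by (simp add: inj_on_def)
  moreover have "\<phi> ` pverts G = pverts G"
    using calculation \<phi>_in by (intro endo_inj_surj) (auto simp: pair_finite_verts)
  moreover have "(\<phi> u, \<phi> v) \<in> parcs G \<longleftrightarrow> (u, v) \<in> parcs G"
    if "u \<in> pverts G" "v \<in> pverts G" for u v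
  proof -
    \<comment> \<open>Surjectivity of \<open>\<psi>\<close> lets the common neighbor range over
      images \<open>\<psi> z\<close>, after which \<open>\<psi>\<close> can be cancelled.\<close>
    have "(\<exists>z\<in>pverts S. (Inl (\<phi> u), z) \<in> parcs S \<and> (Inl (\<phi> v), z) \<in> parcs S) \<longleftrightarrow>
      (\<exists>z\<in>pverts S. (\<psi> (Inl u), \<psi> z) \<in> parcs S \<and> (\<psi> (Inl v), \<psi> z) \<in> parcs S)"
      unfolding \<phi>[OF that(1), symmetric] \<phi>[OF that(2), symmetric]
      using psi_in psi_surj by (metis (no_types, lifting))
    also have "\<dots> \<longleftrightarrow> (\<exists>z\<in>pverts S. (Inl u, z) \<in> parcs S \<and> (Inl v, z) \<in> parcs S)"
      using psi_arc that by (intro bex_cong) auto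
    finally show ?thesis
      using that by (simp only: arc_iff_common_subdivision_neighbour \<phi>_in \<phi>_eq)
  qed
  ultimately have "automorphism G \<phi>" by (simp add: automorphism_def bij_betw_def)
  moreover have "(h \<circ> Inl) (\<phi> v) = (h \<circ> Inl) v" if "v \<in> pverts G" for v
    using assms(3)[of "Inl v"] that \<phi>[OF that] by simp
  ultimately have "\<phi> v = v" if "v \<in> pverts G" for v
    using assms(2) that unfolding distinguishing_def by blast
  then have fix_Inl: "\<psi> (Inl v) = Inl v" if "v \<in> pverts G" for v using \<phi> that by simp
  from assms(4) show ?thesis
  proof (cases rule: subdivision_vertE)
    case (Inl v)
    then show ?thesis using fix_Inl by auto
  next
    case (Inr e)
    note e = Inr(2)
    obtain u v where uv: "e = {u, v}" "u \<noteq> v" "u \<in> pverts G" "v \<in> pverts G"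
      using edgesE[OF e] by metis
    \<comment> \<open>The image of \<open>e\<close> is incident with both fixed ends of
      \<open>e\<close>, and a simple graph has only one such edge.\<close>
    have "(\<psi> (Inl u), \<psi> (Inr e)) \<in> parcs S" "(\<psi> (Inl v), \<psi> (Inr e)) \<in> parcs S"
      using uv e by (simp_all add: psi_arc)
    then obtain f where "\<psi> (Inr e) = Inr f" "f \<in> edges G" "u \<in> f" "v \<in> f"
      using fix_Inl uv by (auto elim!: subdivision_arcE)
    then show ?thesis using Inr uv by (auto elim!: edges_atE[of f u])
  qed
qed

end

lemma (in pair_graph) distinguishing_subdivision_graph:
  assumes "connected (with_proj G)" "\<not> two_regular G" "distinguishing G (h \<circ> Inl)"
  shows "distinguishing (subdivision_graph G) h"
  unfolding distinguishing_def
proof (intro allI impI ballI)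
  fix \<psi> a
  assume \<psi>: "automorphism (subdivision_graph G) \<psi> \<and> (\<forall>v\<in>pverts (subdivision_graph G). h (\<psi> v) = h v)"
    and a: "a \<in> pverts (subdivision_graph G)"
  interpret subdivision_automorphism G \<psi>
    by unfold_locales (use assms \<psi> in auto)
  show "\<psi> a = a"
    using assms \<psi> a by (intro fixes_if_distinguishing) blast+
qed

text \<open>Serves both to lift automorphisms of \<open>G\<close> and to transfer cycles.
  Injectivity of \<open>f\<close> on vertices carries over to edges because edges are subsets of the
  vertex set.\<close>

lemma graph_iso_subdivision_graph:
  assumes "pair_graph G" "pair_graph H" and f: "graph_iso G H f"
  shows "graph_iso (subdivision_graph G) (subdivision_graph H) (map_sum f (image f))"
proof -
  interpret G: pair_graph G by fact
  interpret H: pair_graph H by fact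
  have inj: "inj_on f (pverts G)" and surj: "f ` pverts G = pverts H"
    using f by (auto simp: graph_iso_def bij_betw_def)
  have arc: "(f u, f v) \<in> parcs H \<longleftrightarrow> (u, v) \<in> parcs G" if "u \<in> pverts G" "v \<in> pverts G" for u v
    using f that by (simp add: graph_iso_def)
  have sub: "e \<subseteq> pverts G" if "e \<in> edges G" for e
    using that by (auto elim: G.edgesE)
  have edges: "image f ` edges G = edges H"
  proof (intro equalityI subsetI)
    fix e assume "e \<in> image f ` edges G"
    then show "e \<in> edges H"
      by (auto elim!: G.edgesE simp: H.insert_in_edges_iff arc)
  next
    fix e assume "e \<in> edges H"
    then obtain a b where ab: "e = {a, b}" "(a, b) \<in> parcs H" "a \<in> pverts H" "b \<in> pverts H"
      by (metis H.edgesE)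
    then obtain u v where uv: "u \<in> pverts G" "v \<in> pverts G" "a = f u" "b = f v"
      using surj by blast
    then have "{u, v} \<in> edges G" using ab arc by (simp add: G.insert_in_edges_iff)
    moreover have "e = f ` {u, v}" using ab uv by simp
    ultimately show "e \<in> image f ` edges G" by blast
  qed
  have inj_image: "inj_on (image f) (edges G)"
    using inj_on_image_Pow[OF inj] by (rule inj_on_subset) (use sub in blast)
  have mem: "f v \<in> f ` e \<longleftrightarrow> v \<in> e" if "v \<in> pverts G" "e \<in> edges G" for v e
    using inj that(1) sub[OF that(2)] by (rule inj_on_image_mem_iff)
  show ?thesis
    unfolding graph_iso_def
  proof (intro conjI ballI)
    have "inj_on (map_sum f (image f)) (pverts (subdivision_graph G))"
      by (rule inj_onI) (auto elim!: subdivision_vertE dest: inj_onD[OF inj] inj_onD[OF inj_image])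
    moreover have "map_sum f (image f) ` pverts (subdivision_graph G) = pverts (subdivision_graph H)"
      unfolding surj[symmetric] edges[symmetric] subdivision_graph_def
      by (simp add: Plus_def image_Un image_image)
    ultimately show "bij_betw (map_sum f (image f)) (pverts (subdivision_graph G)) (pverts (subdivision_graph H))"
      by (simp add: bij_betw_def)
    fix a b assume "a \<in> pverts (subdivision_graph G)" "b \<in> pverts (subdivision_graph G)"
    then show "(map_sum f (image f) a, map_sum f (image f) b) \<in> parcs (subdivision_graph H)
      \<longleftrightarrow> (a, b) \<in> parcs (subdivision_graph G)"
      using surj edges mem by (elim subdivision_vertE) auto
  qed
qed

section \<open>Color bounds for subdivision graphs\<close>

lemma distinguishing_cong:
  assumes "\<And>v. v \<in> pverts G \<Longrightarrow> h v = h' v"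
  shows "distinguishing G h \<longleftrightarrow> distinguishing G h'"
  using assms automorphism_in_verts unfolding distinguishing_def by metis

text \<open>Used contrapositively, for the lower bound 3 in (3) and for the star: as soon as
  \<open>G\<close> needs two colors, two are too few for its subdivision.\<close>

lemma (in pair_graph) distinguishing_number_le_1_if_two_colors:
  assumes conn: "connected (with_proj G)"
    and chi: "distinguishing_chromatic_number (subdivision_graph G) \<le> 2"
  shows "distinguishing_number G \<le> 1"
proof -
  let ?S = "subdivision_graph G"
  obtain h where h: "vertex_coloring ?S 2 h" "proper_coloring ?S h" "distinguishing ?S h"
    using chi distinguishing_chromatic_number_le_iff[OF pair_graph_subdivision_graph] by blast
  have range: "h a = 1 \<or> h a = 2" if "a \<in> pverts ?S" for a
    using h(1) that by (force simp: vertex_coloring_def)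
  have proper: "h (Inl v) \<noteq> h (Inr e)" if "v \<in> pverts G" "e \<in> edges G" "v \<in> e" for v e
  proof -
    have "(Inl v, Inr e) \<in> parcs ?S" using that by simp
    then show ?thesis using h(2) by (auto simp: proper_coloring_def simp del: subdivision_graph_simps)
  qed
  have const: "h (Inl u) = h (Inl v)" if "u \<in> pverts G" "v \<in> pverts G" for u v
  proof -
    \<comment> \<open>The trivial right-hand side brings the claim into the form of the induction
      rule, for the property of having the color of \<open>v\<close>.\<close>
    have "h (Inl u) = h (Inl v) \<longleftrightarrow> h (Inl v) = h (Inl v)"
      using pair_graph conn that(2,1)
    proof (induction rule: connected_pair_graph_induct)
      case (step x y)
      have "x \<in> pverts G" "y \<in> pverts G" "{x, y} \<in> edges G"
        using step(1) in_arcsD1 in_arcsD2 by (auto simp: insert_in_edges_iff)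
      then show ?case
        using proper[of x "{x, y}"] proper[of y "{x, y}"] range[of "Inl x"] range[of "Inl y"]
          range[of "Inr {x, y}"] step(2) by auto
    qed
    then show ?thesis by simp
  qed
  have const': "h (Inr e) = h (Inr e')" if e: "e \<in> edges G" "e' \<in> edges G" for e e'
  proof -
    obtain u where "u \<in> e" "u \<in> pverts G" using e(1) by (blast elim: edgesE)
    moreover obtain v where "v \<in> e'" "v \<in> pverts G" using e(2) by (blast elim: edgesE)
    ultimately show ?thesis
      using proper[of u e] proper[of v e'] const[of u v] e range[of "Inr e"] range[of "Inr e'"]
        range[of "Inl v"] by auto
  qed
  have "distinguishing G (\<lambda>_. 1)"
    unfolding distinguishing_def
  proof (intro allI impI ballI)
    fix \<phi> v
    assume "automorphism G \<phi> \<and> (\<forall>v\<in>pverts G. (1::nat) = 1)" and v: "v \<in> pverts G"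
    then have aut: "automorphism ?S (map_sum \<phi> (image \<phi>))" (is "automorphism _ ?\<psi>")
      using graph_iso_subdivision_graph[OF pair_graph pair_graph]
      by (simp add: automorphism_iff_graph_iso)
    have "h (?\<psi> a) = h a" if "a \<in> pverts ?S" for a
      using that
    proof (cases rule: subdivision_vertE)
      case (Inl u)
      then show ?thesis using automorphism_in_verts[OF aut that] const[of "\<phi> u" u] by simp
    next
      case (Inr e)
      then show ?thesis using automorphism_in_verts[OF aut that] const'[of "\<phi> ` e" e] by simp
    qed
    then have "\<forall>a\<in>pverts ?S. ?\<psi> a = a" using h(3) aut unfolding distinguishing_def by blast
    then have "?\<psi> (Inl v) = Inl v" using v by (simp only: subdivision_graph_simps)
    then show "\<phi> v = v" by simp
  qed
  then show ?thesis
    unfolding distinguishing_number_le_iff[OF pair_finite_verts]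
    by (intro exI[of _ "\<lambda>_. 1"]) (simp add: vertex_coloring_def)
qed

lemma (in pair_graph) two_le_distinguishing_chromatic_number:
  assumes "parcs G \<noteq> {}"
  shows "2 \<le> distinguishing_chromatic_number G"
proof (rule ccontr)
  assume "\<not> ?thesis"
  then obtain h where "vertex_coloring G 1 h" "proper_coloring G h"
    using distinguishing_chromatic_number_le_iff[OF pair_graph, of 1] by auto
  moreover obtain u v where "(u, v) \<in> parcs G" using assms by auto
  ultimately show False
    using in_arcsD1[of u v] in_arcsD2[of u v] by (fastforce simp: vertex_coloring_def proper_coloring_def)
qed

text \<open>Keeping \<open>r\<close> separate from the distinguishing number covers (1), with
  \<open>r\<close> equal to it, and also the upper bound 3 when it is only 2.\<close>

lemma (in pair_graph) distinguishing_chromatic_number_subdivision_le: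
  assumes conn: "connected (with_proj G)" and reg: "\<not> two_regular G"
    and r: "3 \<le> r" and D: "distinguishing_number G \<le> r"
  shows "distinguishing_chromatic_number (subdivision_graph G) \<le> r"
proof -
  let ?S = "subdivision_graph G"
  obtain h where h: "vertex_coloring G r h" "distinguishing G h"
    using D distinguishing_number_le_iff[OF pair_finite_verts] by blast
  have "\<exists>c. c \<in> {1..r} \<and> c \<notin> h ` e" if eE: "e \<in> edges G" for e
  proof -
    obtain u v where e: "e = {u, v}" using eE by (blast elim: edgesE)
    have "card {h u, h v} \<le> 2" by (simp add: card_insert_if)
    then have "card (h ` e) < card {1..r}" using r e by simp
    then have "\<not> {1..r} \<subseteq> h ` e" using card_mono[of "h ` e" "{1..r}"] e by auto
    then show ?thesis by blast
  qed
  then obtain c where c: "c e \<in> {1..r}" "c e \<notin> h ` e" if "e \<in> edges G" for e by metis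
  let ?h = "case_sum h c"
  have "vertex_coloring ?S r ?h"
    using h(1) c(1) by (auto simp: vertex_coloring_def elim!: subdivision_vertE)
  moreover have "proper_coloring ?S ?h"
    using c(2) by (force simp: proper_coloring_def elim!: subdivision_arcE)
  moreover have "distinguishing ?S ?h"
    using h(2) by (intro distinguishing_subdivision_graph[OF conn reg]) (simp add: comp_def)
  ultimately show ?thesis
    using distinguishing_chromatic_number_le_iff[OF pair_graph_subdivision_graph] by blast
qed

text \<open>One color already distinguishes \<open>G\<close>, so the two sides of the bipartition
  can serve as the two color classes.\<close>

lemma (in pair_graph) distinguishing_chromatic_number_subdivision_asymmetric:
  assumes conn: "connected (with_proj G)" and reg: "\<not> two_regular G"
    and D: "distinguishing_number G \<le> 1"
  shows "distinguishing_chromatic_number (subdivision_graph G) \<le> 2"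
proof -
  let ?S = "subdivision_graph G"
  obtain h where h: "vertex_coloring G 1 h" "distinguishing G h"
    using D distinguishing_number_le_iff[OF pair_finite_verts] by blast
  let ?h = "case_sum (\<lambda>_. 1) (\<lambda>_. 2) :: 'a + 'a set \<Rightarrow> nat"
  have "distinguishing G (\<lambda>_. 1)"
    using h distinguishing_cong[of G h "\<lambda>_. 1"] by (auto simp: vertex_coloring_def)
  then have "distinguishing ?S ?h"
    by (intro distinguishing_subdivision_graph[OF conn reg]) (simp add: comp_def)
  moreover have "vertex_coloring ?S 2 ?h"
    by (auto simp: vertex_coloring_def elim!: subdivision_vertE)
  moreover have "proper_coloring ?S ?h"
    by (force simp: proper_coloring_def elim!: subdivision_arcE)
  ultimately show ?thesis
    using distinguishing_chromatic_number_le_iff[OF pair_graph_subdivision_graph] by blast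
qed

section \<open>Cycles\<close>

lemma pverts_cycle_graph [simp]: "pverts (cycle_graph n) = {0..<n}"
  by (simp add: cycle_graph_def)

text \<open>Trades \<open>mod\<close> for a case distinction, so that later facts about concrete
  positions reduce to splitting and linear arithmetic.\<close>

lemma cycle_graph_arc_iff:
  "(i, j) \<in> parcs (cycle_graph n) \<longleftrightarrow> i < n \<and> j < n \<and>
     (j = (if Suc i = n then 0 else Suc i) \<or> i = (if Suc j = n then 0 else Suc j))"
proof -
  have "Suc k mod n = (if Suc k = n then 0 else Suc k)" if "k < n" for k
    using that by (simp add: mod_Suc)
  then show ?thesis by (auto simp: cycle_graph_def)
qed

lemma pair_graph_cycle_graph:
  assumes "2 \<le> n"
  shows "pair_graph (cycle_graph n)"
proof (rule pair_graphI)
  fix u v assume "(u, v) \<in> parcs (cycle_graph n)"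
  then show "u \<in> pverts (cycle_graph n) \<and> (v, u) \<in> parcs (cycle_graph n) \<and> u \<noteq> v"
    using assms unfolding cycle_graph_arc_iff by (auto split: if_splits)
qed simp

section \<open>Connected two-regular graphs are cycles\<close>

lemma two_regular_neighbours:
  assumes "two_regular G" "v \<in> pverts G" "(v, a) \<in> parcs G" "(v, b) \<in> parcs G" "a \<noteq> b"
  shows "(v, u) \<in> parcs G \<longleftrightarrow> u = a \<or> u = b"
proof -
  obtain x y where "{u. (v, u) \<in> parcs G} = {x, y}"
    using assms(1,2) unfolding two_regular_def by blast
  then have *: "(v, u) \<in> parcs G \<longleftrightarrow> u = x \<or> u = y" for u by blast
  show ?thesis using assms(3-5) unfolding * by blast
qed

text \<open>With two neighbors at every vertex, a walk can always continue without turning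
  back.\<close>

lemma (in pair_graph) two_regular_walk:
  assumes "two_regular G" "v \<in> pverts G"
  obtains w where "w 0 = v" "\<And>i. (w i, w (Suc i)) \<in> parcs G" "\<And>i. w (Suc (Suc i)) \<noteq> w i"
proof -
  have ex: "\<exists>x. (v, x) \<in> parcs G \<and> x \<noteq> u" if v: "v \<in> pverts G" for u v
  proof -
    obtain x y where xy: "x \<noteq> y" "{u. (v, u) \<in> parcs G} = {x, y}"
      using assms(1) v unfolding two_regular_def by blast
    then have "(v, x) \<in> parcs G" "(v, y) \<in> parcs G" by blast+
    then show ?thesis using xy(1) by metis
  qed
  define nx where "nx u v = (SOME x. (v, x) \<in> parcs G \<and> x \<noteq> u)" for u v
  have nx: "(v, nx u v) \<in> parcs G" "nx u v \<noteq> u" if "v \<in> pverts G" for u v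
    using someI_ex[OF ex[OF that, of u]] by (simp_all add: nx_def)
  \<comment> \<open>The state is the arc last traversed, because the next vertex depends on the last
    two. The initial \<open>nx v v\<close> is simply some neighbor of \<open>v\<close>.\<close>
  define d where "d i = ((\<lambda>(u, v). (v, nx u v)) ^^ i) (v, nx v v)" for i
  have suc: "d (Suc i) = (snd (d i), nx (fst (d i)) (snd (d i)))" for i
    by (simp add: d_def case_prod_unfold)
  have d: "d i \<in> parcs G" for i
  proof (induction i)
    case 0
    then show ?case using nx(1)[OF assms(2)] by (simp add: d_def)
  next
    case (Suc i)
    then show ?case unfolding suc by (intro nx(1) arc_snd_in_verts)
  qed
  show thesis
  proof (rule that[of "fst \<circ> d"])
    fix i
    show "((fst \<circ> d) i, (fst \<circ> d) (Suc i)) \<in> parcs G" using d[of i] by (simp add: suc)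
    show "(fst \<circ> d) (Suc (Suc i)) \<noteq> (fst \<circ> d) i"
      using nx(2)[OF arc_snd_in_verts[OF d[of i]]] by (simp add: suc)
  qed (simp add: d_def)
qed

text \<open>The vertices that a non-backtracking walk visits before its first repetition form a
  closed circuit containing all their neighbors, so connectedness makes them the whole
  graph.\<close>

lemma (in pair_graph) two_regular_imp_graph_iso_cycle:
  assumes conn: "connected (with_proj G)" and reg: "two_regular G" and "pverts G \<noteq> {}"
  obtains f where "graph_iso (cycle_graph (card (pverts G))) G f"
proof -
  obtain v where v: "v \<in> pverts G" using assms(3) by blast
  obtain w where w0: "w 0 = v" and arc: "(w i, w (Suc i)) \<in> parcs G" and ne: "w (Suc (Suc i)) \<noteq> w i" for i
    using two_regular_walk[OF reg v] by metis
  have V: "w i \<in> pverts G" for i using in_arcsD1[OF arc] .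
  have ne1: "w (Suc i) \<noteq> w i" for i using no_loops'[OF arc[of i]] by simp
  have nb: "(w (Suc i), u) \<in> parcs G \<longleftrightarrow> u = w i \<or> u = w (Suc (Suc i))" for i u
    using arc arcs_symmetric[OF arc] ne by (intro two_regular_neighbours[OF reg V]) metis+
  have "\<not> inj w"
    using V pair_finite_verts by (meson finite_imageD finite_subset image_subsetI infinite_UNIV_nat)
  then have ex: "\<exists>j i. i < j \<and> w i = w j"
    by (auto simp: inj_def) (metis linorder_neqE_nat)
  (* At the first repeated vertex w j = w i, two-regularity forces i = 0: otherwise the
     neighbour w (j - 1) of w i would be w (i - 1) or w (i + 1), an earlier repetition. *)
  define j where "j = (LEAST j. \<exists>i<j. w i = w j)"
  obtain i where i: "i < j" "w i = w j"
    using LeastI_ex[OF ex] unfolding j_def by blast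
  have min: "w a \<noteq> w b" if "a < b" "b < j" for a b
    using not_less_Least[of b "\<lambda>j. \<exists>i<j. w i = w j"] that unfolding j_def by blast
  have [simp]: "w a = w b \<longleftrightarrow> a = b" if "a < j" "b < j" for a b
    using min that by (metis linorder_neqE_nat)
  obtain m where m: "j = Suc m" using i(1) by (cases j) auto
  have "i = 0"
  proof (cases i)
    case (Suc k)
    have "(w i, w m) \<in> parcs G" using arcs_symmetric[OF arc[of m]] i m by simp
    then have "w m = w k \<or> w m = w (Suc i)" using nb[of k] Suc by simp
    moreover have "w m \<noteq> w k" using Suc i m min[of k m] by simp
    moreover have "i \<noteq> m" using i(2) ne1[of i] m by auto
    moreover have "Suc i \<noteq> m" using i(2) ne[of i] m by auto
    moreover have "w (Suc i) \<noteq> w m" if "Suc i < m" using min[OF that] m by simp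
    ultimately show ?thesis using i(1) m by auto
  qed
  then have wj: "w (Suc m) = w 0" using i m by simp
  \<comment> \<open>\<open>m = 0\<close> would be a loop, and \<open>m = 1\<close> would mean
    turning back at once.\<close>
  have m2: "m \<ge> 2"
    using wj ne1[of 0] ne[of 0] by (cases m; cases "m - 1") auto
  have nb0: "(w 0, u) \<in> parcs G \<longleftrightarrow> u = w m \<or> u = w 1" for u
  proof (rule two_regular_neighbours[OF reg V])
    show "(w 0, w m) \<in> parcs G" using arcs_symmetric[OF arc[of m]] wj by simp
    show "(w 0, w 1) \<in> parcs G" using arc[of 0] by simp
    show "w m \<noteq> w 1" using m2 m by simp
  qed
  have nbk: "(w k, u) \<in> parcs G \<longleftrightarrow>
      u = w (if k = 0 then m else k - 1) \<or> u = w (if k = m then 0 else Suc k)" if "k \<le> m" for k u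
    using nb[of "k - 1" u] nb0[of u] wj m2 by (cases k) auto
  have surj: "w ` {0..<j} = pverts G"
  proof
    show "w ` {0..<j} \<subseteq> pverts G" using V by auto
    show "pverts G \<subseteq> w ` {0..<j}"
    proof
      fix u assume "u \<in> pverts G"
      with pair_graph conn v have "u \<in> w ` {0..<j} \<longleftrightarrow> v \<in> w ` {0..<j}"
      proof (induction rule: connected_pair_graph_induct)
        case (step x y)
        then obtain k where "x = w k" "k \<le> m" using m by auto
        then have "y = w (if k = 0 then m else k - 1) \<or> y = w (if k = m then 0 else Suc k)"
          using step(1) nbk by blast
        then show ?case using \<open>k \<le> m\<close> m by (auto split: if_splits)
      qed
      then show "u \<in> w ` {0..<j}" using w0 m by auto
    qed
  qed
  have inj: "inj_on w {0..<j}" by (auto simp: inj_on_def)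
  then have card: "card (pverts G) = j" using surj card_image[of w "{0..<j}"] by simp
  have "graph_iso (cycle_graph j) G w"
    unfolding graph_iso_def
  proof (intro conjI ballI)
    show "bij_betw w (pverts (cycle_graph j)) (pverts G)"
      using inj surj by (simp add: bij_betw_def)
    fix k l assume "k \<in> pverts (cycle_graph j)" "l \<in> pverts (cycle_graph j)"
    then have kl: "k \<le> m" "l \<le> m" using m by auto
    then have "(w k, w l) \<in> parcs G \<longleftrightarrow>
      l = (if k = 0 then m else k - 1) \<or> l = (if k = m then 0 else Suc k)"
      using nbk[of k "w l"] m by auto
    also have "\<dots> \<longleftrightarrow> (k, l) \<in> parcs (cycle_graph j)"
      using kl m m2 by (auto simp: cycle_graph_arc_iff)
    finally show "(w k, w l) \<in> parcs G \<longleftrightarrow> (k, l) \<in> parcs (cycle_graph j)" .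
  qed
  then show thesis using that card by blast
qed

section \<open>The subdivision of a cycle\<close>

lemma edges_cycle_graph:
  "edges (cycle_graph n) = (\<lambda>i. {i, if Suc i = n then 0 else Suc i}) ` {0..<n}"
proof (intro equalityI subsetI)
  fix e assume "e \<in> edges (cycle_graph n)"
  then obtain i j where ij: "e = {i, j}" "(i, j) \<in> parcs (cycle_graph n)"
    unfolding edges_def by blast
  from ij(2) consider "i < n" "j = (if Suc i = n then 0 else Suc i)"
    | "j < n" "i = (if Suc j = n then 0 else Suc j)"
    unfolding cycle_graph_arc_iff by blast
  then show "e \<in> (\<lambda>i. {i, if Suc i = n then 0 else Suc i}) ` {0..<n}"
  proof cases
    case 1
    then show ?thesis using ij(1) by (intro image_eqI[of _ _ i]) simp_all
  next
    case 2
    then show ?thesis using ij(1) by (intro image_eqI[of _ _ j]) auto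
  qed
next
  fix e assume "e \<in> (\<lambda>i. {i, if Suc i = n then 0 else Suc i}) ` {0..<n}"
  then obtain i where i: "i < n" "e = {i, if Suc i = n then 0 else Suc i}" by auto
  then have "(i, if Suc i = n then 0 else Suc i) \<in> parcs (cycle_graph n)"
    by (simp add: cycle_graph_arc_iff)
  then show "e \<in> edges (cycle_graph n)" using i(2) unfolding edges_def by blast
qed

text \<open>Going around the subdivided cycle, even positions are the old vertices and the odd
  position \<open>2 * i + 1\<close> is the edge from \<open>i\<close> to its successor.\<close>

lemma graph_iso_cycle_subdivision:
  assumes "3 \<le> n"
  obtains g where "graph_iso (cycle_graph (2 * n)) (subdivision_graph (cycle_graph n)) g"
proof -
  define nx where "nx i = (if Suc i = n then 0 else Suc i)" for i
  define g :: "nat \<Rightarrow> nat + nat set" where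
    "g k = (if even k then Inl (k div 2) else Inr {k div 2, nx (k div 2)})" for k
  have g [simp]: "g (2 * i) = Inl i" "g (Suc (2 * i)) = Inr {i, nx i}" for i
    by (simp_all add: g_def)
  \<comment> \<open>Here \<open>3 \<le> n\<close> matters: on two vertices the edges starting at 0
    and at 1 would be the same set.\<close>
  have nx_eq: "{i, nx i} = {j, nx j} \<longleftrightarrow> i = j" if "i < n" "j < n" for i j
    using that assms by (auto simp: nx_def doubleton_eq_iff split: if_splits)
  have edges: "edges (cycle_graph n) = (\<lambda>i. {i, nx i}) ` {0..<n}"
    unfolding edges_cycle_graph nx_def by simp
  have parity: "(\<exists>i<n. k = 2 * i) \<or> (\<exists>i<n. k = Suc (2 * i))" if "k < 2 * n" for k
    using that by presburger
  have "graph_iso (cycle_graph (2 * n)) (subdivision_graph (cycle_graph n)) g"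
    unfolding graph_iso_def
  proof (intro conjI ballI)
    have "inj_on g {0..<2 * n}"
    proof (rule inj_onI)
      fix k l assume kl: "k \<in> {0..<2 * n}" "l \<in> {0..<2 * n}" "g k = g l"
      then show "k = l" using parity[of k] parity[of l] by (auto simp: nx_eq)
    qed
    moreover have "g ` {0..<2 * n} = pverts (subdivision_graph (cycle_graph n))"
    proof (intro equalityI subsetI)
      fix a assume "a \<in> g ` {0..<2 * n}"
      then obtain k where "k < 2 * n" "a = g k" by auto
      then show "a \<in> pverts (subdivision_graph (cycle_graph n))"
        using parity[of k] by (auto simp: edges)
    next
      fix a assume "a \<in> pverts (subdivision_graph (cycle_graph n))"
      then show "a \<in> g ` {0..<2 * n}"
      proof (cases rule: subdivision_vertE)
        case (Inl i)
        then show ?thesis by (intro image_eqI[of _ _ "2 * i"]) auto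
      next
        case (Inr e)
        then obtain i where "i < n" "e = {i, nx i}" unfolding edges by auto
        then show ?thesis using Inr by (intro image_eqI[of _ _ "Suc (2 * i)"]) auto
      qed
    qed
    ultimately show "bij_betw g (pverts (cycle_graph (2 * n))) (pverts (subdivision_graph (cycle_graph n)))"
      by (simp add: bij_betw_def)
    fix k l assume "k \<in> pverts (cycle_graph (2 * n))" "l \<in> pverts (cycle_graph (2 * n))"
    then have kl: "k < 2 * n" "l < 2 * n" by auto
    have mixed: "(2 * i, Suc (2 * j)) \<in> parcs (cycle_graph (2 * n)) \<longleftrightarrow> i \<in> {j, nx j}"
      "(Suc (2 * j), 2 * i) \<in> parcs (cycle_graph (2 * n)) \<longleftrightarrow> i \<in> {j, nx j}"
      if "i < n" "j < n" for i j
      using that by (auto simp: cycle_graph_arc_iff nx_def)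
    have same: "(2 * i, 2 * j) \<notin> parcs (cycle_graph (2 * n))"
      "(Suc (2 * i), Suc (2 * j)) \<notin> parcs (cycle_graph (2 * n))" for i j
      unfolding cycle_graph_arc_iff by presburger+
    have edge: "{i, nx i} \<in> edges (cycle_graph n)" if "i < n" for i
      using that by (simp add: edges)
    show "(g k, g l) \<in> parcs (subdivision_graph (cycle_graph n)) \<longleftrightarrow> (k, l) \<in> parcs (cycle_graph (2 * n))"
      using parity[OF kl(1)] parity[OF kl(2)]
      by (elim disjE exE conjE) (simp_all add: mixed same edge)
  qed
  then show thesis by (rule that)
qed

section \<open>Automorphisms of cycles\<close>

lemma automorphism_cycle_arc:
  assumes "automorphism (cycle_graph n) \<psi>" "(i, j) \<in> parcs (cycle_graph n)"
  shows "(\<psi> i, \<psi> j) \<in> parcs (cycle_graph n)"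
proof -
  have "i < n" "j < n" using assms(2) by (simp_all add: cycle_graph_arc_iff)
  then show ?thesis using assms by (simp add: automorphism_def)
qed

lemma automorphism_eq_iff:
  "automorphism G \<psi> \<Longrightarrow> u \<in> pverts G \<Longrightarrow> v \<in> pverts G \<Longrightarrow> \<psi> u = \<psi> v \<longleftrightarrow> u = v"
  by (auto simp: automorphism_def bij_betw_def inj_on_eq_iff)

text \<open>Once two consecutive vertices are fixed, the next one must go to a neighbor of the
  second other than the first, which leaves only itself.\<close>

lemma automorphism_cycle_eq_id:
  assumes \<psi>: "automorphism (cycle_graph n) \<psi>" and fix01: "\<psi> 0 = 0" "\<psi> 1 = 1" and "i < n"
  shows "\<psi> i = i"
proof -
  have *: "\<psi> i = i \<and> \<psi> (Suc i) = Suc i" if "Suc i < n" for i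
    using that
  proof (induction i)
    case 0
    then show ?case using fix01 by simp
  next
    case (Suc i)
    then have IH: "\<psi> i = i" "\<psi> (Suc i) = Suc i" by simp_all
    have "(Suc i, Suc (Suc i)) \<in> parcs (cycle_graph n)"
      using Suc.prems by (simp add: cycle_graph_arc_iff)
    then have "(Suc i, \<psi> (Suc (Suc i))) \<in> parcs (cycle_graph n)"
      using automorphism_cycle_arc[OF \<psi>] IH by metis
    moreover have "\<psi> (Suc (Suc i)) \<noteq> i"
      using automorphism_eq_iff[OF \<psi>, of "Suc (Suc i)" i] Suc.prems IH by simp
    ultimately show ?case
      using Suc.prems IH by (auto simp: cycle_graph_arc_iff split: if_splits)
  qed
  show ?thesis using *[of "i - 1"] assms(4) fix01 by (cases i) auto
qed

lemma distinguishing_cycleI: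
  assumes "\<And>\<psi>. automorphism (cycle_graph n) \<psi> \<Longrightarrow> (\<And>i. i < n \<Longrightarrow> \<psi> i < n \<and> h (\<psi> i) = h i) \<Longrightarrow>
    \<psi> 0 = 0 \<and> \<psi> 1 = 1"
  shows "distinguishing (cycle_graph n) h"
  unfolding distinguishing_def
proof (intro allI impI ballI)
  fix \<psi> v
  assume \<psi>: "automorphism (cycle_graph n) \<psi> \<and> (\<forall>v\<in>pverts (cycle_graph n). h (\<psi> v) = h v)"
    and v: "v \<in> pverts (cycle_graph n)"
  have "\<psi> i < n" if "i < n" for i using automorphism_in_verts[of "cycle_graph n" \<psi> i] \<psi> that by simp
  then have "\<psi> 0 = 0 \<and> \<psi> 1 = 1" using assms[of \<psi>] \<psi> by simp
  then show "\<psi> v = v" using automorphism_cycle_eq_id[of n \<psi> v] \<psi> v by simp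
qed

definition cycle_rotation :: "nat \<Rightarrow> nat \<Rightarrow> nat \<Rightarrow> nat" where
  "cycle_rotation n k i = (if i + k < n then i + k else i + k - n)"

text \<open>This is \<open>k - i\<close> modulo \<open>n\<close>, written without
  \<open>mod\<close>. All reflections arise for \<open>k < n\<close>; for even \<open>n\<close>,
  those with even \<open>k\<close> fix two opposite vertices and those with odd \<open>k\<close> fix
  none.\<close>

definition cycle_reflection :: "nat \<Rightarrow> nat \<Rightarrow> nat \<Rightarrow> nat" where
  "cycle_reflection n k i = (if i \<le> k then k - i else k + n - i)"

text \<open>The two alternatives of \<open>step\<close> say that \<open>f\<close> preserves or
  reverses the orientation: in the second, \<open>f (s i)\<close> is the predecessor of
  \<open>f i\<close>.\<close>

lemma automorphism_cycleI:
  fixes n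
  defines "s \<equiv> \<lambda>i. if Suc i = n then 0 else Suc i"
  assumes f: "\<And>i. i < n \<Longrightarrow> f i < n" "inj_on f {0..<n}"
    and step: "(\<forall>i<n. f (s i) = s (f i)) \<or> (\<forall>i<n. s (f (s i)) = f i)"
  shows "automorphism (cycle_graph n) f"
proof -
  have s: "s i < n" if "i < n" for i using that by (simp add: s_def)
  have s_eq: "s i = s j \<longleftrightarrow> i = j" if "i < n" "j < n" for i j
    using that by (auto simp: s_def)
  have f_eq: "f i = f j \<longleftrightarrow> i = j" if "i < n" "j < n" for i j
    using inj_onD[OF f(2)] that by auto
  have arc: "(i, j) \<in> parcs (cycle_graph n) \<longleftrightarrow> j = s i \<or> i = s j" if "i < n" "j < n" for i j
    using that by (simp add: cycle_graph_arc_iff s_def)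
  have "f j = s (f i) \<or> f i = s (f j) \<longleftrightarrow> j = s i \<or> i = s j"
    if ij: "i < n" "j < n" for i j
    using step
  proof
    assume "\<forall>i<n. f (s i) = s (f i)"
    then show ?thesis using ij s f_eq by metis
  next
    assume *: "\<forall>i<n. s (f (s i)) = f i"
    have "f b = s (f a) \<longleftrightarrow> a = s b" if "a < n" "b < n" for a b
      using * that s s_eq f_eq f(1) by metis
    then show ?thesis using ij by blast
  qed
  then have "(f i, f j) \<in> parcs (cycle_graph n) \<longleftrightarrow> (i, j) \<in> parcs (cycle_graph n)"
    if "i < n" "j < n" for i j
    using that f(1) arc by metis
  moreover have "f ` {0..<n} = {0..<n}"
    using f(1) by (intro endo_inj_surj f(2)) auto
  ultimately show ?thesis using f(2) by (simp add: automorphism_def bij_betw_def)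
qed

lemma automorphism_cycle_rotation:
  assumes "k < n"
  shows "automorphism (cycle_graph n) (cycle_rotation n k)"
proof (rule automorphism_cycleI)
  show "inj_on (cycle_rotation n k) {0..<n}"
    using assms by (intro inj_onI) (auto simp: cycle_rotation_def split: if_splits)
qed (use assms in \<open>auto simp: cycle_rotation_def\<close>)

lemma automorphism_cycle_reflection:
  assumes "k < n"
  shows "automorphism (cycle_graph n) (cycle_reflection n k)"
proof (rule automorphism_cycleI)
  show "inj_on (cycle_reflection n k) {0..<n}"
    using assms by (intro inj_onI) (auto simp: cycle_reflection_def split: if_splits)
  show "(\<forall>i<n. cycle_reflection n k (if Suc i = n then 0 else Suc i) =
      (if Suc (cycle_reflection n k i) = n then 0 else Suc (cycle_reflection n k i))) \<or>
    (\<forall>i<n. (if Suc (cycle_reflection n k (if Suc i = n then 0 else Suc i)) = n then 0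
      else Suc (cycle_reflection n k (if Suc i = n then 0 else Suc i))) = cycle_reflection n k i)"
    using assms by (intro disjI2) (auto simp: cycle_reflection_def)
qed (use assms in \<open>auto simp: cycle_reflection_def\<close>)

lemma distinguishing_cycle_rotation:
  assumes "distinguishing (cycle_graph n) h" "0 < k" "k < n"
  shows "\<exists>i<n. h (cycle_rotation n k i) \<noteq> h i"
proof (rule ccontr)
  assume "\<not> ?thesis"
  then have "\<forall>v\<in>pverts (cycle_graph n). h (cycle_rotation n k v) = h v" by auto
  then have "cycle_rotation n k 0 = 0"
    using assms automorphism_cycle_rotation[of k n] unfolding distinguishing_def by fastforce
  then show False using assms by (simp add: cycle_rotation_def)
qed

text \<open>No reflection is the identity: fixing 0 forces \<open>k = 0\<close>, and then 1 goes to
  \<open>n - 1\<close>, which differs from 1 because \<open>3 \<le> n\<close>.\<close>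

lemma distinguishing_cycle_reflection:
  assumes "distinguishing (cycle_graph n) h" "3 \<le> n" "k < n"
  shows "\<exists>i<n. h (cycle_reflection n k i) \<noteq> h i"
proof (rule ccontr)
  assume "\<not> ?thesis"
  then have "\<forall>v\<in>pverts (cycle_graph n). h (cycle_reflection n k v) = h v" by auto
  then have fix_all: "\<forall>v\<in>pverts (cycle_graph n). cycle_reflection n k v = v"
    using assms automorphism_cycle_reflection[of k n] unfolding distinguishing_def by blast
  then have "cycle_reflection n k 0 = 0" "cycle_reflection n k 1 = 1" using assms(2) by simp_all
  then show False using assms by (simp add: cycle_reflection_def split: if_splits)
qed

lemma automorphism_cycle_neighbour:
  assumes "automorphism (cycle_graph n) \<psi>" "Suc i < n"
  shows "(\<psi> i, \<psi> (Suc i)) \<in> parcs (cycle_graph n)"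
  using automorphism_cycle_arc[OF assms(1), of i "Suc i"] assms(2) by (simp add: cycle_graph_arc_iff)

section \<open>Distinguishing numbers of cycles\<close>

lemma two_le_distinguishing_number_cycle:
  assumes "3 \<le> n"
  shows "2 \<le> distinguishing_number (cycle_graph n)"
proof (rule ccontr)
  assume "\<not> ?thesis"
  then obtain h where h: "vertex_coloring (cycle_graph n) 1 h" "distinguishing (cycle_graph n) h"
    using distinguishing_number_le_iff[of "cycle_graph n" 1] by auto
  obtain i where "i < n" "h (cycle_rotation n 1 i) \<noteq> h i"
    using distinguishing_cycle_rotation[OF h(2), of 1] assms by auto
  moreover have "cycle_rotation n 1 i < n" using calculation by (auto simp: cycle_rotation_def)
  moreover have "h a = 1" if "a < n" for a
    using h(1) that by (force simp: vertex_coloring_def)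
  ultimately show False by metis
qed

lemma distinguishing_number_cycle_le_3:
  assumes "3 \<le> n"
  shows "distinguishing_number (cycle_graph n) \<le> 3"
proof -
  let ?h = "\<lambda>i::nat. if i = 0 then 1 else if i = 1 then 2 else 3 :: nat"
  have "distinguishing (cycle_graph n) ?h"
  proof (rule distinguishing_cycleI)
    fix \<psi> assume h: "\<And>i. i < n \<Longrightarrow> \<psi> i < n \<and> ?h (\<psi> i) = ?h i"
    have "?h (\<psi> 0) = 1" "?h (\<psi> 1) = 2" using h[of 0] h[of 1] assms by simp_all
    moreover have "x = 0" if "?h x = 1" for x using that by (simp split: if_splits)
    moreover have "x = 1" if "?h x = 2" for x using that by (simp split: if_splits)
    ultimately show "\<psi> 0 = 0 \<and> \<psi> 1 = 1" by blast
  qed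
  moreover have "vertex_coloring (cycle_graph n) 3 ?h" by (auto simp: vertex_coloring_def)
  ultimately show ?thesis using distinguishing_number_le_iff[of "cycle_graph n" 3] by auto
qed

lemma distinguishing_number_cycle_le_2:
  assumes "6 \<le> n"
  shows "distinguishing_number (cycle_graph n) \<le> 2"
proof -
  \<comment> \<open>In this class 0 and 1 are adjacent and 3 is adjacent to neither. Vertex 3 is at
    distance 2 from 1 but, as \<open>6 \<le> n\<close>, at distance 3 from 0, so 0 and 1 cannot be
    exchanged. With \<open>n = 5\<close> a reflection would exchange them and fix 3.\<close>
  let ?h = "\<lambda>i::nat. if i \<in> {0, 1, 3} then 2 else 1 :: nat"
  have "distinguishing (cycle_graph n) ?h"
  proof (rule distinguishing_cycleI)
    fix \<psi> assume \<psi>: "automorphism (cycle_graph n) \<psi>"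
      and h: "\<And>i. i < n \<Longrightarrow> \<psi> i < n \<and> ?h (\<psi> i) = ?h i"
    have in_set: "\<psi> 0 \<in> {0, 1, 3}" "\<psi> 1 \<in> {0, 1, 3}" "\<psi> 3 \<in> {0, 1, 3}"
    proof -
      have "?h (\<psi> 0) = 2" "?h (\<psi> 1) = 2" "?h (\<psi> 3) = 2"
        using h[of 0] h[of 1] h[of 3] assms by simp_all
      moreover have "x \<in> {0, 1, 3}" if "?h x = 2" for x using that by (simp split: if_splits)
      ultimately show "\<psi> 0 \<in> {0, 1, 3}" "\<psi> 1 \<in> {0, 1, 3}" "\<psi> 3 \<in> {0, 1, 3}" by blast+
    qed
    have ne: "\<psi> 0 \<noteq> \<psi> 1" "\<psi> 0 \<noteq> \<psi> 3" "\<psi> 1 \<noteq> \<psi> 3"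
      using assms by (simp_all add: automorphism_eq_iff[OF \<psi>])
    have arcs: "(\<psi> 0, \<psi> 1) \<in> parcs (cycle_graph n)" "(\<psi> 1, \<psi> 2) \<in> parcs (cycle_graph n)"
      "(\<psi> 2, \<psi> 3) \<in> parcs (cycle_graph n)"
      using automorphism_cycle_neighbour[OF \<psi>, of 0] automorphism_cycle_neighbour[OF \<psi>, of 1]
        automorphism_cycle_neighbour[OF \<psi>, of 2] assms by (simp_all add: eval_nat_numeral)
    have "\<psi> 0 \<noteq> 3" "\<psi> 1 \<noteq> 3"
      using in_set(1,2) ne(1) arcs(1) assms by (auto simp: cycle_graph_arc_iff split: if_splits)
    then have "\<psi> 3 = 3" using in_set ne by auto
    \<comment> \<open>Otherwise \<open>\<psi> 2\<close> would be a common neighbor of 0 and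
      3.\<close>
    moreover have "\<not> (\<psi> 1 = 0 \<and> \<psi> 3 = 3)"
      using arcs(2,3) assms by (auto simp: cycle_graph_arc_iff split: if_splits)
    ultimately show "\<psi> 0 = 0 \<and> \<psi> 1 = 1" using in_set ne by auto
  qed
  moreover have "vertex_coloring (cycle_graph n) 2 ?h" by (auto simp: vertex_coloring_def)
  ultimately show ?thesis using distinguishing_number_le_iff[of "cycle_graph n" 2] by auto
qed

text \<open>One of the two color classes has at most two vertices. The reflection with
  \<open>k = a + b\<close> modulo \<open>n\<close> exchanges \<open>a\<close> and \<open>b\<close>,
  and the case \<open>a = b\<close> fixes a single vertex, so some reflection always preserves the
  coloring. The proof checks all colorings against all reflections.\<close>

lemma three_le_distinguishing_number_small_cycle:
  assumes "n \<in> {3, 4, 5}"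
  shows "3 \<le> distinguishing_number (cycle_graph n)"
proof (rule ccontr)
  assume "\<not> ?thesis"
  then obtain h where h: "vertex_coloring (cycle_graph n) 2 h" "distinguishing (cycle_graph n) h"
    using distinguishing_number_le_iff[of "cycle_graph n" 2] by auto
  have two: "h i = 1 \<or> h i = 2" if "i < n" for i
    using h(1) that by (force simp: vertex_coloring_def)
  have n3: "3 \<le> n" using assms by auto
  have refl: "\<exists>i\<in>{..<n}. h (cycle_reflection n k i) \<noteq> h i" if "k < n" for k
    using distinguishing_cycle_reflection[OF h(2) n3 that] by auto
  consider "n = 3" | "n = 4" | "n = 5" using assms by blast
  then show False
  proof cases
    case 1
    then show False using refl[of 0] refl[of 1] refl[of 2] two[of 0] two[of 1] two[of 2]
      by (simp add: cycle_reflection_def eval_nat_numeral lessThan_Suc) (elim disjE; simp)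
  next
    case 2
    then show False using refl[of 0] refl[of 1] refl[of 2] refl[of 3]
        two[of 0] two[of 1] two[of 2] two[of 3]
      by (simp add: cycle_reflection_def eval_nat_numeral lessThan_Suc) (elim disjE; simp)
  next
    case 3
    then show False using refl[of 0] refl[of 1] refl[of 2] refl[of 3] refl[of 4]
        two[of 0] two[of 1] two[of 2] two[of 3] two[of 4]
      by (simp add: cycle_reflection_def eval_nat_numeral lessThan_Suc) (elim disjE; simp)
  qed
qed

section \<open>Proper distinguishing colorings of cycles\<close>

text \<open>A proper coloring with two colors alternates, hence is invariant under rotation by two
  steps.\<close>

lemma three_le_distinguishing_chromatic_number_cycle:
  assumes "3 \<le> n"
  shows "3 \<le> distinguishing_chromatic_number (cycle_graph n)"
proof (rule ccontr)
  assume "\<not> ?thesis"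
  then obtain h where h: "vertex_coloring (cycle_graph n) 2 h" "proper_coloring (cycle_graph n) h"
    "distinguishing (cycle_graph n) h"
    using distinguishing_chromatic_number_le_iff[OF pair_graph_cycle_graph[of n], of 2] assms by auto
  obtain i where i: "i < n" "h (cycle_rotation n 2 i) \<noteq> h i"
    using distinguishing_cycle_rotation[OF h(3), of 2] assms by auto
  have two: "h j = 1 \<or> h j = 2" if "j < n" for j
    using h(1) that by (force simp: vertex_coloring_def)
  \<comment> \<open>The vertex between \<open>i\<close> and its rotated image; both differ from it
    in color, so they agree.\<close>
  define j where "j = (if Suc i = n then 0 else Suc i)"
  have arcs: "(i, j) \<in> parcs (cycle_graph n)" "(j, cycle_rotation n 2 i) \<in> parcs (cycle_graph n)"
    using i(1) assms by (auto simp: j_def cycle_graph_arc_iff cycle_rotation_def)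
  then have "h i \<noteq> h j" "h j \<noteq> h (cycle_rotation n 2 i)"
    using h(2) by (auto simp: proper_coloring_def)
  moreover have "j < n" "cycle_rotation n 2 i < n"
    using arcs(2) by (auto simp: cycle_graph_arc_iff)
  ultimately show False using i two[of i] two[of j] two[of "cycle_rotation n 2 i"] by auto
qed

lemma proper_coloring_cycleI:
  assumes "\<And>i. Suc i < n \<Longrightarrow> h i \<noteq> h (Suc i)" "h (n - 1) \<noteq> h 0"
  shows "proper_coloring (cycle_graph n) h"
  unfolding proper_coloring_def
proof (intro ballI, clarify)
  fix i j assume *: "(i, j) \<in> parcs (cycle_graph n)" "h i = h j"
  have "h a \<noteq> h (if Suc a = n then 0 else Suc a)" if "a < n" for a
    using assms(1)[of a] assms(2) that by auto
  then show False using * unfolding cycle_graph_arc_iff by metis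
qed

lemma distinguishing_chromatic_number_even_cycle_le_3:
  assumes "8 \<le> n" "even n"
  shows "distinguishing_chromatic_number (cycle_graph n) \<le> 3"
proof -
  \<comment> \<open>The alternating coloring with two vertices recolored. Their positions have
    opposite parity, so the neighbors of 0 all have color 2 and those of 3 all have color 1, which
    prevents exchanging them.\<close>
  let ?h = "\<lambda>i::nat. if i \<in> {0, 3} then 3 else if even i then 1 else 2 :: nat"
  have "distinguishing (cycle_graph n) ?h"
  proof (rule distinguishing_cycleI)
    fix \<psi> assume \<psi>: "automorphism (cycle_graph n) \<psi>"
      and h: "\<And>i. i < n \<Longrightarrow> \<psi> i < n \<and> ?h (\<psi> i) = ?h i"
    have in_set: "\<psi> 0 \<in> {0, 3}" "\<psi> 3 \<in> {0, 3}" "odd (\<psi> 1)"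
    proof -
      have "?h (\<psi> 0) = 3" "?h (\<psi> 1) = 2" "?h (\<psi> 3) = 3"
        using h[of 0] h[of 1] h[of 3] assms by simp_all
      moreover have "x \<in> {0, 3}" if "?h x = 3" for x using that by (simp split: if_splits)
      moreover have "odd x" if "?h x = 2" for x using that by (simp split: if_splits)
      ultimately show "\<psi> 0 \<in> {0, 3}" "\<psi> 3 \<in> {0, 3}" "odd (\<psi> 1)" by blast+
    qed
    have ne: "\<psi> 0 \<noteq> \<psi> 3"
      using assms by (simp add: automorphism_eq_iff[OF \<psi>])
    have arcs: "(\<psi> 0, \<psi> 1) \<in> parcs (cycle_graph n)" "(\<psi> 1, \<psi> 2) \<in> parcs (cycle_graph n)"
      "(\<psi> 2, \<psi> 3) \<in> parcs (cycle_graph n)"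
      using automorphism_cycle_neighbour[OF \<psi>, of 0] automorphism_cycle_neighbour[OF \<psi>, of 1]
        automorphism_cycle_neighbour[OF \<psi>, of 2] assms by (simp_all add: eval_nat_numeral)
    have "\<psi> 0 \<noteq> 3"
      using arcs(1) in_set(3) assms by (auto simp: cycle_graph_arc_iff split: if_splits)
    then have "\<psi> 0 = 0" "\<psi> 3 = 3" using in_set ne by auto
    \<comment> \<open>With 0 and 3 fixed, \<open>\<psi> 1\<close> and \<open>\<psi> 2\<close> lie on
      a path of length three between them. For \<open>8 \<le> n\<close> the other way around has
      length \<open>n - 3\<close>, at least five; on the hexagon both ways have length three and a
      reflection would survive.\<close>
    then show "\<psi> 0 = 0 \<and> \<psi> 1 = 1"
      using arcs assms by (auto simp: cycle_graph_arc_iff split: if_splits)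
  qed
  moreover have "proper_coloring (cycle_graph n) ?h"
  proof (rule proper_coloring_cycleI)
    have "odd (n - 1)" "n - 1 \<noteq> 3" using assms by auto
    then show "?h (n - 1) \<noteq> ?h 0" by auto
  qed auto
  moreover have "vertex_coloring (cycle_graph n) 3 ?h" by (auto simp: vertex_coloring_def)
  ultimately show ?thesis
    using distinguishing_chromatic_number_le_iff[OF pair_graph_cycle_graph[of n], of 3] assms by auto
qed

lemma distinguishing_chromatic_number_cycle_6_le_4: "distinguishing_chromatic_number (cycle_graph 6) \<le> 4"
proof -
  let ?h = "\<lambda>i::nat. if i = 0 then 3 else if i = 1 then 4 else if even i then 1 else 2 :: nat"
  have "distinguishing (cycle_graph 6) ?h"
  proof (rule distinguishing_cycleI)
    fix \<psi> assume h: "\<And>i. i < 6 \<Longrightarrow> \<psi> i < 6 \<and> ?h (\<psi> i) = ?h i"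
    have "?h (\<psi> 0) = 3" "?h (\<psi> 1) = 4" using h[of 0] h[of 1] by simp_all
    moreover have "x = 0" if "?h x = 3" for x using that by (simp split: if_splits)
    moreover have "x = 1" if "?h x = 4" for x using that by (simp split: if_splits)
    ultimately show "\<psi> 0 = 0 \<and> \<psi> 1 = 1" by blast
  qed
  moreover have "proper_coloring (cycle_graph 6) ?h"
    by (rule proper_coloring_cycleI) auto
  moreover have "vertex_coloring (cycle_graph 6) 4 ?h" by (auto simp: vertex_coloring_def)
  ultimately show ?thesis
    using distinguishing_chromatic_number_le_iff[OF pair_graph_cycle_graph[of 6], of 4] by auto
qed

lemma four_le_distinguishing_chromatic_number_cycle_6: "4 \<le> distinguishing_chromatic_number (cycle_graph 6)"
proof (rule ccontr)
  assume "\<not> ?thesis"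
  then obtain h where h: "vertex_coloring (cycle_graph 6) 3 h" "proper_coloring (cycle_graph 6) h"
    "distinguishing (cycle_graph 6) h"
    using distinguishing_chromatic_number_le_iff[OF pair_graph_cycle_graph[of 6], of 3] by auto
  have three: "h i = 1 \<or> h i = 2 \<or> h i = 3" if "i < 6" for i
    using h(1) that by (force simp: vertex_coloring_def)
  have ne: "h i \<noteq> h j" if "(i, j) \<in> parcs (cycle_graph 6)" for i j
    using h(2) that by (auto simp: proper_coloring_def)
  have ne': "h 0 \<noteq> h 1" "h 1 \<noteq> h 2" "h 2 \<noteq> h 3" "h 3 \<noteq> h 4" "h 4 \<noteq> h 5" "h 5 \<noteq> h 0"
    by (rule ne, simp add: cycle_graph_arc_iff)+
  \<comment> \<open>Only even \<open>k\<close> will be used: for odd \<open>k\<close> the reflection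
    swaps the ends of an edge and can never preserve a proper coloring.\<close>
  have refl: "\<exists>i\<in>{..<6}. h (cycle_reflection 6 k i) \<noteq> h i" if "k < 6" for k
    using distinguishing_cycle_reflection[OF h(3) _ that] by auto
  (* Every proper 3-coloring of the hexagon is invariant under a reflection through two opposite
     vertices or under the antipodal map. *)
  have "h 1 \<noteq> h 5 \<or> h 2 \<noteq> h 4"
    using refl[of 0] by (simp add: cycle_reflection_def eval_nat_numeral lessThan_Suc) metis
  moreover have "h 0 \<noteq> h 2 \<or> h 3 \<noteq> h 5"
    using refl[of 2] by (simp add: cycle_reflection_def eval_nat_numeral lessThan_Suc) metis
  moreover have "h 0 \<noteq> h 4 \<or> h 1 \<noteq> h 3"
    using refl[of 4] by (simp add: cycle_reflection_def eval_nat_numeral lessThan_Suc) metis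
  moreover have "h 0 \<noteq> h 3 \<or> h 1 \<noteq> h 4 \<or> h 2 \<noteq> h 5"
  proof -
    have "\<exists>i\<in>{..<6}. h (cycle_rotation 6 3 i) \<noteq> h i"
      using distinguishing_cycle_rotation[OF h(3), of 3] by auto
    then show ?thesis
      by (simp add: cycle_rotation_def eval_nat_numeral lessThan_Suc) metis
  qed
  ultimately show False
    using three[of 0] three[of 1] three[of 2] three[of 3] three[of 4] three[of 5] ne'
    by (simp; smt (verit))
qed

section \<open>Transfer between cycles and graphs isomorphic to them\<close>

lemma two_regular_imp_isomorphic_cycle:
  fixes G :: "'a pair_pre_digraph"
  assumes "connected_graph_of_order n G" "3 \<le> n" "two_regular G"
  shows "isomorphic G (cycle_graph n)"
proof -
  interpret pair_graph G using assms(1) by (simp add: connected_graph_of_order_def)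
  have n: "connected (with_proj G)" "card (pverts G) = n"
    using assms(1) by (simp_all add: connected_graph_of_order_def)
  then have "pverts G \<noteq> {}" using assms(2) by auto
  then obtain f where "graph_iso (cycle_graph n) G f"
    using two_regular_imp_graph_iso_cycle[OF n(1) assms(3)] n(2) by metis
  moreover have "pair_graph (cycle_graph n)" using assms(2) by (simp add: pair_graph_cycle_graph)
  ultimately show ?thesis
    using graph_iso_imp_isomorphic[OF graph_iso_inv] pair_graph pair_graph_imp_pair_wf_digraph
    by blast
qed

lemma numbers_of_isomorphic_cycle:
  fixes G :: "'a pair_pre_digraph"
  assumes "connected_graph_of_order n G" "3 \<le> n" "isomorphic G (cycle_graph n)"
  shows "distinguishing_number G = distinguishing_number (cycle_graph n)"
    and "distinguishing_chromatic_number (subdivision_graph G) =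
      distinguishing_chromatic_number (cycle_graph (2 * n))"
proof -
  have G: "pair_graph G" using assms(1) by (simp add: connected_graph_of_order_def)
  have C: "pair_graph (cycle_graph n)" "pair_graph (cycle_graph (2 * n))"
    using assms(2) by (simp_all add: pair_graph_cycle_graph)
  obtain f where f: "graph_iso G (cycle_graph n) f"
    using isomorphic_imp_graph_iso[OF assms(3) pair_graph_imp_pair_wf_digraph[OF G]] .
  then show "distinguishing_number G = distinguishing_number (cycle_graph n)"
    by (rule distinguishing_number_graph_iso)
  obtain g where g: "graph_iso (cycle_graph (2 * n)) (subdivision_graph (cycle_graph n)) g"
    using graph_iso_cycle_subdivision[OF assms(2)] .
  have "graph_iso (subdivision_graph G) (subdivision_graph (cycle_graph n)) (map_sum f (image f))"
    using G C(1) f by (rule graph_iso_subdivision_graph)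
  then have "graph_iso (subdivision_graph G) (cycle_graph (2 * n))
      (the_inv_into (pverts (cycle_graph (2 * n))) g \<circ> map_sum f (image f))"
    using graph_iso_inv[OF g] by (rule graph_iso_comp)
  moreover have "pair_graph (subdivision_graph G)"
    using G by (rule pair_graph.pair_graph_subdivision_graph)
  ultimately show "distinguishing_chromatic_number (subdivision_graph G) =
      distinguishing_chromatic_number (cycle_graph (2 * n))"
    using distinguishing_chromatic_number_graph_iso C(2) pair_graph_imp_pair_wf_digraph by metis
qed

lemma distinguishing_numbers_cycle:
  assumes "3 \<le> n"
  shows "n = 3 \<or> 6 \<le> n \<Longrightarrow>
      distinguishing_chromatic_number (cycle_graph (2 * n)) = distinguishing_number (cycle_graph n) + 1"
    and "n = 4 \<or> n = 5 \<Longrightarrow>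
      distinguishing_chromatic_number (cycle_graph (2 * n)) = distinguishing_number (cycle_graph n)"
proof -
  have chi: "distinguishing_chromatic_number (cycle_graph (2 * n)) = 3" if "4 \<le> n"
    using that three_le_distinguishing_chromatic_number_cycle[of "2 * n"] distinguishing_chromatic_number_even_cycle_le_3[of "2 * n"] by simp
  have chi6: "distinguishing_chromatic_number (cycle_graph 6) = 4"
    using distinguishing_chromatic_number_cycle_6_le_4 four_le_distinguishing_chromatic_number_cycle_6 by simp
  have D3: "distinguishing_number (cycle_graph n) = 3" if "n \<in> {3, 4, 5}"
    using that assms three_le_distinguishing_number_small_cycle[of n]
      distinguishing_number_cycle_le_3[of n] by simp
  have D2: "distinguishing_number (cycle_graph n) = 2" if "6 \<le> n"
    using that two_le_distinguishing_number_cycle[of n] distinguishing_number_cycle_le_2[of n] by simp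
  show "distinguishing_chromatic_number (cycle_graph (2 * n)) = distinguishing_number (cycle_graph n) + 1"
    if "n = 3 \<or> 6 \<le> n"
    using that chi chi6 D3 D2 by (cases "n = 3") auto
  show "distinguishing_chromatic_number (cycle_graph (2 * n)) = distinguishing_number (cycle_graph n)"
    if "n = 4 \<or> n = 5"
    using that chi D3 by auto
qed

lemma two_le_distinguishing_chromatic_number_subdivision:
  assumes "connected_graph_of_order n G" "3 \<le> n"
  shows "2 \<le> distinguishing_chromatic_number (subdivision_graph G)"
proof -
  interpret pair_graph G using assms(1) by (simp add: connected_graph_of_order_def)
  have conn: "connected (with_proj G)" and card: "card (pverts G) = n"
    using assms(1) by (simp_all add: connected_graph_of_order_def)
  obtain v where v: "v \<in> pverts G" using card assms(2) by fastforce
  have "parcs G \<noteq> {}"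
  proof
    assume empty: "parcs G = {}"
    have "u = v" if "u \<in> pverts G" for u
    proof -
      \<comment> \<open>Without arcs the induction step is vacuous, so the property of being
        \<open>v\<close> would hold throughout the graph.\<close>
      have "u = v \<longleftrightarrow> v = v" using pair_graph conn v that
        by (induction rule: connected_pair_graph_induct) (use empty in simp)
      then show ?thesis by simp
    qed
    then have "pverts G \<subseteq> {v}" by blast
    then have "card (pverts G) \<le> 1" using card_mono[of "{v}" "pverts G"] by simp
    then show False using card assms(2) by simp
  qed
  then obtain u w where uw: "(u, w) \<in> parcs G" by auto
  then have "(Inl u, Inr {u, w}) \<in> parcs (subdivision_graph G)"
    using in_arcsD1[OF uw] by (simp add: insert_in_edges_iff)
  then show ?thesis
    by (intro pair_graph.two_le_distinguishing_chromatic_number[OF pair_graph_subdivision_graph]) blast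
qed

section \<open>The star with three leaves\<close>

definition star_graph :: "nat pair_pre_digraph" where
  "star_graph = \<lparr> pverts = {0..<4},
     parcs = {(i, j). i = 0 \<and> j \<in> {1, 2, 3} \<or> j = 0 \<and> i \<in> {1, 2, 3}} \<rparr>"

lemma star_graph_simps [simp]:
  "pverts star_graph = {0..<4}"
  "(i, j) \<in> parcs star_graph \<longleftrightarrow> i = 0 \<and> j \<in> {1, 2, 3} \<or> j = 0 \<and> i \<in> {1, 2, 3}"
  by (auto simp: star_graph_def)

lemma pair_graph_star_graph: "pair_graph star_graph"
  by (rule pair_graphI) auto

lemma connected_star_graph: "connected (with_proj star_graph)"
  unfolding connected_conv
proof (intro conjI ballI)
  show "verts (with_proj star_graph) \<noteq> {}" by simp
  let ?R = "rtrancl_on (verts (with_proj star_graph)) ((arcs_ends (with_proj star_graph))\<^sup>s)"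
  fix u v assume uv: "u \<in> verts (with_proj star_graph)" "v \<in> verts (with_proj star_graph)"
  have zero: "(0, 0) \<in> ?R" by (rule rtrancl_on_refl) simp
  have to: "(0, w) \<in> ?R" if "w \<in> verts (with_proj star_graph)" for w
  proof (cases "w = 0")
    case False
    then have "(0, w) \<in> parcs star_graph" using that by auto
    then have "(0, w) \<in> (arcs_ends (with_proj star_graph))\<^sup>s" by (simp add: symcl_def)
    then show ?thesis using zero that rtrancl_on_into_rtrancl_on by metis
  qed (use zero in simp)
  moreover have "(u, 0) \<in> ?R"
  proof (cases "u = 0")
    case False
    then have "(u, 0) \<in> parcs star_graph" using uv(1) by auto
    then have "(u, 0) \<in> (arcs_ends (with_proj star_graph))\<^sup>s" by (simp add: symcl_def)
    then show ?thesis using zero uv(1) converse_rtrancl_on_into_rtrancl_on by metis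
  qed (use zero in simp)
  ultimately show "(u, v) \<in> ?R" using uv(2) rtrancl_on_trans by metis
qed

lemma not_isomorphic_star_cycle: "\<not> isomorphic star_graph (cycle_graph 4)"
proof
  assume "isomorphic star_graph (cycle_graph 4)"
  then obtain f where f: "graph_iso star_graph (cycle_graph 4) f"
    using isomorphic_imp_graph_iso pair_graph_imp_pair_wf_digraph[OF pair_graph_star_graph] by blast
  have "inj_on f {0..<4}" using f by (simp add: graph_iso_def bij_betw_def)
  then have "f 1 \<noteq> f 2" "f 1 \<noteq> f 3" "f 2 \<noteq> f 3" by (simp_all add: inj_on_eq_iff)
  moreover have "(f 0, f 1) \<in> parcs (cycle_graph 4)" "(f 0, f 2) \<in> parcs (cycle_graph 4)"
    "(f 0, f 3) \<in> parcs (cycle_graph 4)"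
    using f by (simp_all add: graph_iso_def)
  moreover have "x = y \<or> x = z \<or> y = z" if "(w, x) \<in> parcs (cycle_graph 4)"
    "(w, y) \<in> parcs (cycle_graph 4)" "(w, z) \<in> parcs (cycle_graph 4)" for w x y z
  proof -
    \<comment> \<open>A neighbor of \<open>w\<close> is its successor or its predecessor, and the
      latter is unique because \<open>s\<close> is injective; hence a cycle vertex cannot match the
      center of the star.\<close>
    define s :: "nat \<Rightarrow> nat" where "s i = (if Suc i = 4 then 0 else Suc i)" for i
    have "v < 4 \<and> (v = s w \<or> s v = w)" if "(w, v) \<in> parcs (cycle_graph 4)" for v
      using that by (auto simp: cycle_graph_arc_iff s_def)
    moreover have "s u = s v \<longleftrightarrow> u = v" for u v by (simp add: s_def)
    ultimately show ?thesis using that by metis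
  qed
  ultimately show False by metis
qed

lemma not_two_regular_star_graph: "\<not> two_regular star_graph"
proof
  assume "two_regular star_graph"
  then have "\<exists>x y. x \<noteq> y \<and> {u. (1, u) \<in> parcs star_graph} = {x, y}"
    unfolding two_regular_def by (rule bspec) simp
  moreover have "{u. (1, u) \<in> parcs star_graph} = {0}" by auto
  ultimately show False by (auto simp: doubleton_eq_iff)
qed

lemma distinguishing_number_star_graph: "distinguishing_number star_graph = 3"
proof (rule antisym)
  \<comment> \<open>The center may share the color of leaf 1: leaves 2 and 3 are fixed by their
    colors, and adjacency to leaf 2 then fixes the center.\<close>
  let ?h = "\<lambda>i::nat. if i = 0 then 1 else i"
  have "distinguishing star_graph ?h"
    unfolding distinguishing_def
  proof (intro allI impI ballI)
    fix \<psi> v assume \<psi>: "automorphism star_graph \<psi> \<and> (\<forall>v\<in>pverts star_graph. ?h (\<psi> v) = ?h v)"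
      and v: "v \<in> pverts star_graph"
    then have h_eq: "?h (\<psi> i) = ?h i" if "i \<in> pverts star_graph" for i using that by blast
    have h: "?h (\<psi> 1) = 1" "?h (\<psi> 2) = 2" "?h (\<psi> 3) = 3"
      using h_eq[of 1] h_eq[of 2] h_eq[of 3] by simp_all
    have two: "x = 2" if "?h x = 2" for x using that by (simp split: if_splits)
    have three: "x = 3" if "?h x = 3" for x using that by (simp split: if_splits)
    have one: "x = 0 \<or> x = 1" if "?h x = 1" for x using that by (simp split: if_splits)
    have f23: "\<psi> 2 = 2" "\<psi> 3 = 3" using two h(2) three h(3) by blast+
    have arc: "(\<psi> a, \<psi> b) \<in> parcs star_graph" if "(a, b) \<in> parcs star_graph" for a b
    proof -
      have "a \<in> pverts star_graph" "b \<in> pverts star_graph" using that by auto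
      then show ?thesis using \<psi> that unfolding automorphism_def by blast
    qed
    have "\<psi> 0 = 0" using arc[of 0 2] f23 by simp
    moreover have "\<psi> 1 = 1" using arc[of 0 1] one[OF h(1)] calculation by auto
    moreover have "v = 0 \<or> v = 1 \<or> v = 2 \<or> v = 3" using v by auto
    ultimately show "\<psi> v = v" using f23 by metis
  qed
  moreover have "vertex_coloring star_graph 3 ?h" by (auto simp: vertex_coloring_def)
  ultimately show "distinguishing_number star_graph \<le> 3"
    using distinguishing_number_le_iff[of star_graph 3] by auto
  show "3 \<le> distinguishing_number star_graph"
  proof (rule ccontr)
    assume "\<not> ?thesis"
    then obtain h where h: "vertex_coloring star_graph 2 h" "distinguishing star_graph h"
      using distinguishing_number_le_iff[of star_graph 2] by auto
    have ne: "h a \<noteq> h b" if ab: "a \<in> {1, 2, 3}" "b \<in> {1, 2, 3}" "a \<noteq> b" for a b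
    proof
      assume eq: "h a = h b"
      \<comment> \<open>Exchanging two leaves is an automorphism, so equally colored leaves would
        contradict \<open>distinguishing\<close>.\<close>
      let ?t = "id(a := b, b := a)"
      have "bij_betw ?t {0..<4} {0..<4}"
        by (rule bij_betw_byWitness[where f' = ?t]) (use ab in auto)
      then have "automorphism star_graph ?t"
        using ab by (auto simp: automorphism_def)
      moreover have "\<forall>v\<in>pverts star_graph. h (?t v) = h v" using eq by auto
      ultimately have "\<forall>v\<in>pverts star_graph. ?t v = v"
        using h(2) unfolding distinguishing_def by blast
      moreover have "a \<in> pverts star_graph" using ab by auto
      ultimately have "?t a = a" by blast
      then show False using ab(3) by simp
    qed
    have two: "h i = 1 \<or> h i = 2" if "i < 4" for i
      using h(1) that by (force simp: vertex_coloring_def)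
    have "h 1 \<noteq> h 2" "h 1 \<noteq> h 3" "h 2 \<noteq> h 3" by (rule ne; simp)+
    moreover have "h 1 = 1 \<or> h 1 = 2" "h 2 = 1 \<or> h 2 = 2" "h 3 = 1 \<or> h 3 = 2"
      by (rule two; simp)+
    ultimately show False by metis
  qed
qed

lemma distinguishing_chromatic_number_subdivision_star:
  "distinguishing_chromatic_number (subdivision_graph star_graph) = 3"
proof (rule antisym)
  interpret pair_graph star_graph by (rule pair_graph_star_graph)
  show "distinguishing_chromatic_number (subdivision_graph star_graph) \<le> 3"
    using distinguishing_number_star_graph
    by (intro distinguishing_chromatic_number_subdivision_le connected_star_graph
        not_two_regular_star_graph) simp_all
  show "3 \<le> distinguishing_chromatic_number (subdivision_graph star_graph)"
    using distinguishing_number_le_1_if_two_colors[OF connected_star_graph]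
      distinguishing_number_star_graph by linarith
qed

theorem theorem4p7:
  shows "(\<forall>(G :: 'a pair_pre_digraph) n.
            connected_graph_of_order n G \<and> n \<ge> 3 \<and>
            \<not> isomorphic G (cycle_graph n) \<and> distinguishing_number G \<ge> 3 \<longrightarrow>
            distinguishing_chromatic_number (subdivision_graph G) \<le> distinguishing_number G)
       \<and> (\<exists>(G :: nat pair_pre_digraph) n.
            connected_graph_of_order n G \<and> n \<ge> 3 \<and>
            \<not> isomorphic G (cycle_graph n) \<and> distinguishing_number G \<ge> 3 \<and>
            distinguishing_chromatic_number (subdivision_graph G) = distinguishing_number G)
       \<and> (\<forall>(G :: 'a pair_pre_digraph) n.
            connected_graph_of_order n G \<and> n \<ge> 3 \<and>
            \<not> isomorphic G (cycle_graph n) \<and> distinguishing_number G = 2 \<longrightarrow>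
            distinguishing_chromatic_number (subdivision_graph G) = 3)
       \<and> (\<forall>(G :: 'a pair_pre_digraph) n.
            connected_graph_of_order n G \<and> n \<ge> 3 \<and>
            distinguishing_number G = 1 \<longrightarrow>
            distinguishing_chromatic_number (subdivision_graph G) = 2)
       \<and> (\<forall>(G :: 'a pair_pre_digraph) n.
            connected_graph_of_order n G \<and> n \<ge> 3 \<and>
            isomorphic G (cycle_graph n) \<and> (n = 3 \<or> n \<ge> 6) \<longrightarrow>
            distinguishing_chromatic_number (subdivision_graph G) = distinguishing_number G + 1)
       \<and> (\<forall>(G :: 'a pair_pre_digraph) n.
            connected_graph_of_order n G \<and> n \<ge> 3 \<and>
            isomorphic G (cycle_graph n) \<and> (n = 4 \<or> n = 5) \<longrightarrow>
            distinguishing_chromatic_number (subdivision_graph G) = distinguishing_number G)"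
proof (intro conjI allI impI; (elim conjE)?)
  fix G :: "'a pair_pre_digraph" and n
  assume G: "connected_graph_of_order n G" "3 \<le> n"
  interpret pair_graph G using G(1) by (simp add: connected_graph_of_order_def)
  have conn: "connected (with_proj G)" using G(1) by (simp add: connected_graph_of_order_def)
  have reg: "\<not> two_regular G" if "\<not> isomorphic G (cycle_graph n)"
    using that two_regular_imp_isomorphic_cycle[OF G] by blast
  note upper = distinguishing_chromatic_number_subdivision_le[OF conn reg]
  {
    assume "\<not> isomorphic G (cycle_graph n)" "3 \<le> distinguishing_number G"
    then show "distinguishing_chromatic_number (subdivision_graph G) \<le> distinguishing_number G"
      using upper by simp
  }
  {
    assume "\<not> isomorphic G (cycle_graph n)" "distinguishing_number G = 2"
    moreover from this have "distinguishing_chromatic_number (subdivision_graph G) \<le> 3"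
      using upper[of 3] by simp
    ultimately show "distinguishing_chromatic_number (subdivision_graph G) = 3"
      using distinguishing_number_le_1_if_two_colors[OF conn] by linarith
  }
  {
    assume D: "distinguishing_number G = 1"
    \<comment> \<open>Part (4) does not exclude cycles explicitly; a cycle has nontrivial rotations
      and so needs at least two colors.\<close>
    have "\<not> isomorphic G (cycle_graph n)"
      using D numbers_of_isomorphic_cycle(1)[OF G] two_le_distinguishing_number_cycle[OF G(2)] by auto
    then have "distinguishing_chromatic_number (subdivision_graph G) \<le> 2"
      using D distinguishing_chromatic_number_subdivision_asymmetric[OF conn reg] by simp
    then show "distinguishing_chromatic_number (subdivision_graph G) = 2"
      using two_le_distinguishing_chromatic_number_subdivision[OF G] by simp
  }
  {
    assume "isomorphic G (cycle_graph n)" "n = 3 \<or> 6 \<le> n"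
    then show "distinguishing_chromatic_number (subdivision_graph G) = distinguishing_number G + 1"
      using numbers_of_isomorphic_cycle[OF G] distinguishing_numbers_cycle(1)[OF G(2)] by simp
  }
  {
    assume "isomorphic G (cycle_graph n)" "n = 4 \<or> n = 5"
    then show "distinguishing_chromatic_number (subdivision_graph G) = distinguishing_number G"
      using numbers_of_isomorphic_cycle[OF G] distinguishing_numbers_cycle(2)[OF G(2)] by simp
  }
next
  have "connected_graph_of_order 4 star_graph"
    by (simp add: connected_graph_of_order_def pair_graph_star_graph connected_star_graph)
  then show "\<exists>(G :: nat pair_pre_digraph) n.
            connected_graph_of_order n G \<and> n \<ge> 3 \<and>
            \<not> isomorphic G (cycle_graph n) \<and> distinguishing_number G \<ge> 3 \<and>
            distinguishing_chromatic_number (subdivision_graph G) = distinguishing_number G"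
    using not_isomorphic_star_cycle distinguishing_number_star_graph
      distinguishing_chromatic_number_subdivision_star
    by (intro exI[of _ star_graph] exI[of _ 4]) simp
qed

end
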